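(* Let $X$ be a union of conjugacy classes of a group regarded as a rack, assumed braided, $q$ a two-cocycle, $V=\Bbbk X$ the realization over $\Bbbk G_X$, and assume $\mathcal B(V)$ is slim in degree two. Let $a,b,c\in X$ be pairwise distinct with $a\triangleright b\ne b$. Let $d=c\triangleright(b\triangleright a)$, $e=d\triangleright(c\triangleright b)$, $S=\{v_a,v_b,v_d,v_e\}$, and $$Z=\mu(\mathrm{id}-c_1c_2+(c_1c_2)^2)(v_c\otimes v_b\otimes v_a)\in\mathcal B(V)(3),$$ and let $C$ be the subalgebra of $\mathcal B(V)$ generated by $S\cup\{Z\}$. Then (1) $C$ is a left coideal subalgebra of $\mathcal B(V)$ in the category of $\mathbb N_0$-graded $\Bbbk G_X$-comodules; (2) if $c$ commutes with none of $a$, $b$, $b\triangleright a$ and if $a\triangleright b\ne c$ or $a\triangleright c\ne b\triangleright a$, then $Z\notin\langle S\rangle$, so $C$ is not generated in degree one.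
   Context: $\Bbbk$ algebraically closed of characteristic $0$. Rack, braided rack (quandle with, for all $x,y$, $x\triangleright y=y$ or $x\triangleright(y\triangleright x)=y$), two-cocycle ($q_{x\triangleright y,x\triangleright z}q_{x,z}=q_{x,y\triangleright z}q_{y,z}$), $G_X=\langle g_x\mid g_xg_y=g_{x\triangleright y}g_x\rangle$. Realization: $V=\Bbbk X$, basis $v_x$, $\deg v_x=g_x$, $g_x\cdot v_y=q_{x,y}v_{x\triangleright y}$, braiding $c_q(v_x\otimes v_y)=q_{x,y}v_{x\triangleright y}\otimes v_x$. On $V^{\otimes n}$, $c_i$ denotes $c_q$ applied to tensor factors $i,i+1$; $\mu$ is multiplication in the Nichols algebra $\mathcal B(V)$. Elements $x,y$ commute if $x\triangleright y=y$. $\mathcal B(V)$ is slim in degree two if $\mu(\mathrm{id}-c_q)(v_a\otimes v_b)=0$ for all $a,b$ with $a\triangleright b=b\ne a$, and $\mu(\mathrm{id}-c_q+c_q^2)(v_a\otimes v_b)=0$ for all $a,b$ with $a\triangleright b\ne b$. Left coideal subalgebra in the category of $\mathbb N_0$-graded $\Bbbk G_X$-comodules: $\mathbb N_0$-graded $G_X$-graded subalgebra $C\ni1$ with $\Delta(C)\subseteq\mathcal B(V)\otimes C$; generated in degree one: generated by $C\cap V$. *)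

theory Defs
  imports "HOL-Algebra.Group" "HOL-Computational_Algebra.Polynomial"
begin

definition conj_act :: "('g, 'm) monoid_scheme \<Rightarrow> 'g \<Rightarrow> 'g \<Rightarrow> 'g" where
  "conj_act G x y = x \<otimes>\<^bsub>G\<^esub> y \<otimes>\<^bsub>G\<^esub> inv\<^bsub>G\<^esub> x"

definition braided_rack :: "'x set \<Rightarrow> ('x \<Rightarrow> 'x \<Rightarrow> 'x) \<Rightarrow> bool" where
  "braided_rack X act \<longleftrightarrow> (\<forall>x\<in>X. \<forall>y\<in>X. act x y = y \<or> act x (act y x) = y)"

definition commutes :: "('x \<Rightarrow> 'x \<Rightarrow> 'x) \<Rightarrow> 'x \<Rightarrow> 'x \<Rightarrow> bool" where
  "commutes act x y \<longleftrightarrow> act x y = y"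

definition two_cocycle :: "'x set \<Rightarrow> ('x \<Rightarrow> 'x \<Rightarrow> 'x) \<Rightarrow> ('x \<Rightarrow> 'x \<Rightarrow> 'k::field) \<Rightarrow> bool" where
  "two_cocycle X act q \<longleftrightarrow> (\<forall>x\<in>X. \<forall>y\<in>X. q x y \<noteq> 0) \<and>
     (\<forall>x\<in>X. \<forall>y\<in>X. \<forall>z\<in>X. q (act x y) (act x z) * q x z = q x (act y z) * q y z)"

(* Vectors of the tensor algebra T(V), V = kX: coefficient functions on words *)
definition supp :: "('a \<Rightarrow> 'k::zero) \<Rightarrow> 'a set" where
  "supp f = {w. f w \<noteq> 0}"

definition wd :: "'a \<Rightarrow> 'a \<Rightarrow> 'k::comm_ring_1" where
  "wd u = (\<lambda>w. if w = u then 1 else 0)"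

definition lext :: "('a \<Rightarrow> 'b \<Rightarrow> 'k::comm_ring_1) \<Rightarrow> ('a \<Rightarrow> 'k) \<Rightarrow> 'b \<Rightarrow> 'k" where
  "lext B f = (\<lambda>w. \<Sum>u\<in>supp f. f u * B u w)"

(* c_{i+1} (0-indexed position i): c(v_x \<otimes> v_y) = q_{x,y} v_{x\<triangleright>y} \<otimes> v_x *)
definition braid_word :: "('x \<Rightarrow> 'x \<Rightarrow> 'x) \<Rightarrow> ('x \<Rightarrow> 'x \<Rightarrow> 'k::comm_ring_1) \<Rightarrow> nat \<Rightarrow> 'x list \<Rightarrow> 'x list \<Rightarrow> 'k" where
  "braid_word act q i u =
     (if Suc i < length u
      then (\<lambda>w. if w = u[i := act (u!i) (u!Suc i), Suc i := u!i] then q (u!i) (u!Suc i) else 0)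
      else wd u)"

definition braid :: "('x \<Rightarrow> 'x \<Rightarrow> 'x) \<Rightarrow> ('x \<Rightarrow> 'x \<Rightarrow> 'k::comm_ring_1) \<Rightarrow> nat \<Rightarrow> ('x list \<Rightarrow> 'k) \<Rightarrow> 'x list \<Rightarrow> 'k" where
  "braid act q i = lext (braid_word act q i)"

definition hom :: "nat \<Rightarrow> ('x list \<Rightarrow> 'k::zero) \<Rightarrow> 'x list \<Rightarrow> 'k" where
  "hom n f = (\<lambda>w. if length w = n then f w else 0)"

definition append_letter :: "('x list \<Rightarrow> 'k::zero) \<Rightarrow> 'x \<Rightarrow> 'x list \<Rightarrow> 'k" where
  "append_letter g x = (\<lambda>w. if w \<noteq> [] \<and> last w = x then g (butlast w) else 0)"

definition on_init :: "(('x list \<Rightarrow> 'k) \<Rightarrow> 'x list \<Rightarrow> 'k) \<Rightarrow> ('x list \<Rightarrow> 'k::comm_ring_1) \<Rightarrow> 'x list \<Rightarrow> 'k" where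
  "on_init F = lext (\<lambda>u. if u = [] then wd [] else append_letter (F (wd (butlast u))) (last u))"

(* c_{m-1} c_{m-2} ... c_{m-j} *)
definition braid_chain :: "('x \<Rightarrow> 'x \<Rightarrow> 'x) \<Rightarrow> ('x \<Rightarrow> 'x \<Rightarrow> 'k::comm_ring_1) \<Rightarrow> nat \<Rightarrow> nat \<Rightarrow> ('x list \<Rightarrow> 'k) \<Rightarrow> 'x list \<Rightarrow> 'k" where
  "braid_chain act q m j = foldr (\<circ>) (map (braid act q) (rev [m - 1 - j..<m - 1])) id"

definition Tsh :: "('x \<Rightarrow> 'x \<Rightarrow> 'x) \<Rightarrow> ('x \<Rightarrow> 'x \<Rightarrow> 'k::comm_ring_1) \<Rightarrow> nat \<Rightarrow> ('x list \<Rightarrow> 'k) \<Rightarrow> 'x list \<Rightarrow> 'k" where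
  "Tsh act q m f = (\<lambda>w. \<Sum>j<m. braid_chain act q m j f w)"

fun qsym :: "('x \<Rightarrow> 'x \<Rightarrow> 'x) \<Rightarrow> ('x \<Rightarrow> 'x \<Rightarrow> 'k::comm_ring_1) \<Rightarrow> nat \<Rightarrow> ('x list \<Rightarrow> 'k) \<Rightarrow> 'x list \<Rightarrow> 'k" where
  "qsym act q 0 f = f"
| "qsym act q (Suc n) f = on_init (qsym act q n) (Tsh act q (Suc n) f)"

(* f represents 0 in the Nichols algebra B(V) = T(V) / (\<oplus>_n ker Omega_n) *)
definition nichols_zero :: "('x \<Rightarrow> 'x \<Rightarrow> 'x) \<Rightarrow> ('x \<Rightarrow> 'x \<Rightarrow> 'k::comm_ring_1) \<Rightarrow> ('x list \<Rightarrow> 'k) \<Rightarrow> bool" where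
  "nichols_zero act q f \<longleftrightarrow> (\<forall>n. qsym act q n (hom n f) = (\<lambda>_. 0))"

definition tmul :: "('x list \<Rightarrow> 'k::comm_ring_1) \<Rightarrow> ('x list \<Rightarrow> 'k) \<Rightarrow> 'x list \<Rightarrow> 'k" where
  "tmul f g = (\<lambda>w. \<Sum>i\<le>length w. f (take i w) * g (drop i w))"

inductive_set gen_alg :: "('x list \<Rightarrow> 'k::comm_ring_1) set \<Rightarrow> ('x list \<Rightarrow> 'k) set" for A where
  unit: "wd [] \<in> gen_alg A"
| base: "f \<in> A \<Longrightarrow> f \<in> gen_alg A"
| add: "f \<in> gen_alg A \<Longrightarrow> g \<in> gen_alg A \<Longrightarrow> (\<lambda>w. f w + g w) \<in> gen_alg A"
| smult: "f \<in> gen_alg A \<Longrightarrow> (\<lambda>w. k * f w) \<in> gen_alg A"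
| mult: "f \<in> gen_alg A \<Longrightarrow> g \<in> gen_alg A \<Longrightarrow> tmul f g \<in> gen_alg A"

(* preimage in T(V) (= finitely supported vectors on words over X) of the image of A in B(V) *)
definition nsat :: "('x \<Rightarrow> 'x \<Rightarrow> 'x) \<Rightarrow> ('x \<Rightarrow> 'x \<Rightarrow> 'k::comm_ring_1) \<Rightarrow> 'x set \<Rightarrow> ('x list \<Rightarrow> 'k) set \<Rightarrow> ('x list \<Rightarrow> 'k) set" where
  "nsat act q X A = {f. finite (supp f) \<and> supp f \<subseteq> lists X \<and>
      (\<exists>u\<in>A. nichols_zero act q (\<lambda>w. f w - u w))}"

(* coproduct of T(V) on words: Delta(v_x m) = (v_x \<otimes> 1 + 1 \<otimes> v_x) Delta(m) in the braided tensor product *)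
fun cop_word :: "('x \<Rightarrow> 'x \<Rightarrow> 'x) \<Rightarrow> ('x \<Rightarrow> 'x \<Rightarrow> 'k::comm_ring_1) \<Rightarrow> 'x list \<Rightarrow> 'x list \<times> 'x list \<Rightarrow> 'k" where
  "cop_word act q [] = wd ([], [])"
| "cop_word act q (x # w) =
     lext (\<lambda>(p, r) t. (if t = (x # p, r) then 1 else 0)
                     + (if t = (map (act x) p, x # r) then (\<Prod>i<length p. q x (p ! i)) else 0))
          (cop_word act q w)"

definition cop :: "('x \<Rightarrow> 'x \<Rightarrow> 'x) \<Rightarrow> ('x \<Rightarrow> 'x \<Rightarrow> 'k::comm_ring_1) \<Rightarrow> ('x list \<Rightarrow> 'k) \<Rightarrow> 'x list \<times> 'x list \<Rightarrow> 'k" where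
  "cop act q = lext (cop_word act q)"

(* Equality in the enveloping group G_X = < g_x | g_x g_y = g_{x \<triangleright> y} g_x >, on signed words *)
inductive gx_eq :: "'x set \<Rightarrow> ('x \<Rightarrow> 'x \<Rightarrow> 'x) \<Rightarrow> ('x \<times> bool) list \<Rightarrow> ('x \<times> bool) list \<Rightarrow> bool"
  for X act where
  refl: "gx_eq X act u u"
| sym: "gx_eq X act u v \<Longrightarrow> gx_eq X act v u"
| trans: "gx_eq X act u v \<Longrightarrow> gx_eq X act v s \<Longrightarrow> gx_eq X act u s"
| ctxt: "gx_eq X act u v \<Longrightarrow> gx_eq X act (p @ u @ s) (p @ v @ s)"
| cancel: "x \<in> X \<Longrightarrow> gx_eq X act [(x, e), (x, \<not> e)] []"
| rel: "x \<in> X \<Longrightarrow> y \<in> X \<Longrightarrow> gx_eq X act [(x, True), (y, True)] [(act x y, True), (x, True)]"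

definition same_deg :: "'x set \<Rightarrow> ('x \<Rightarrow> 'x \<Rightarrow> 'x) \<Rightarrow> 'x list \<Rightarrow> 'x list \<Rightarrow> bool" where
  "same_deg X act w w' \<longleftrightarrow> gx_eq X act (map (\<lambda>x. (x, True)) w) (map (\<lambda>x. (x, True)) w')"

(* Left coideal subalgebra of B(V) in the category of N_0-graded kG_X-comodules,
   C given as its (saturated) preimage in T(V) *)
definition left_coideal_subalg :: "('x \<Rightarrow> 'x \<Rightarrow> 'x) \<Rightarrow> ('x \<Rightarrow> 'x \<Rightarrow> 'k::comm_ring_1) \<Rightarrow> 'x set \<Rightarrow> ('x list \<Rightarrow> 'k) set \<Rightarrow> bool" where
  "left_coideal_subalg act q X C \<longleftrightarrow>
     wd [] \<in> C \<and>
     (\<forall>f\<in>C. \<forall>g\<in>C. (\<lambda>w. f w + g w) \<in> C \<and> tmul f g \<in> C) \<and>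
     (\<forall>f\<in>C. \<forall>k. (\<lambda>w. k * f w) \<in> C) \<and>
     (\<forall>f\<in>C. \<forall>n. hom n f \<in> C) \<and>
     (\<forall>f\<in>C. \<forall>w0. (\<lambda>w. if same_deg X act w w0 then f w else 0) \<in> C) \<and>
     (\<forall>f\<in>C. \<exists>H. finite (supp H) \<and> supp H \<subseteq> lists X \<times> lists X \<and>
          (\<forall>l. (\<lambda>r. H (l, r)) \<in> C) \<and>
          (\<forall>r. nichols_zero act q (\<lambda>l. cop act q f (l, r) - H (l, r))))"

definition gen_in_deg_one :: "('x \<Rightarrow> 'x \<Rightarrow> 'x) \<Rightarrow> ('x \<Rightarrow> 'x \<Rightarrow> 'k::comm_ring_1) \<Rightarrow> 'x set \<Rightarrow> ('x list \<Rightarrow> 'k) set \<Rightarrow> bool" where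
  "gen_in_deg_one act q X C \<longleftrightarrow>
     C = nsat act q X (gen_alg {f\<in>C. \<exists>u. (\<forall>w\<in>supp u. length w = 1) \<and> nichols_zero act q (\<lambda>w. f w - u w)})"

definition slim2 :: "('x \<Rightarrow> 'x \<Rightarrow> 'x) \<Rightarrow> ('x \<Rightarrow> 'x \<Rightarrow> 'k::comm_ring_1) \<Rightarrow> 'x set \<Rightarrow> bool" where
  "slim2 act q X \<longleftrightarrow>
     (\<forall>a\<in>X. \<forall>b\<in>X. act a b = b \<and> b \<noteq> a \<longrightarrow>
        nichols_zero act q (\<lambda>w. wd [a, b] w - braid act q 0 (wd [a, b]) w)) \<and>
     (\<forall>a\<in>X. \<forall>b\<in>X. act a b \<noteq> b \<longrightarrow>
        nichols_zero act q (\<lambda>w. wd [a, b] w - braid act q 0 (wd [a, b]) w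
                                 + braid act q 0 (braid act q 0 (wd [a, b])) w))"

definition Zelem :: "('x \<Rightarrow> 'x \<Rightarrow> 'x) \<Rightarrow> ('x \<Rightarrow> 'x \<Rightarrow> 'k::comm_ring_1) \<Rightarrow> 'x \<Rightarrow> 'x \<Rightarrow> 'x \<Rightarrow> 'x list \<Rightarrow> 'k" where
  "Zelem act q c b a =
     (let u = wd [c, b, a]; B = (\<lambda>f. braid act q 0 (braid act q 1 f))
      in (\<lambda>w. u w - B u w + B (B u) w))"

end

theory Submission
  imports Defs
begin

text \<open>The defining ideal of the Nichols algebra is the largest homogeneous subspace in positive degree that is
  stable under the right skew derivations \<open>\<partial>\<^sub>y\<close>; hence it is a two-sided ideal and, since iterated
  derivations separate points of the quotient, a coideal. So it suffices to find \<open>\<Delta>(Z)\<close>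
  in \<open>B(V) \<otimes> C\<close>: in degree \<open>(2,1)\<close> the terms ending in \<open>v\<^sub>c\<close> add up to the relation of
  \<open>v\<^sub>h v\<^sub>e\<close> with \<open>h = c \<triangleright> b\<close>, and in degree \<open>(1,2)\<close> the only component not
  visibly in the subalgebra is \<open>v\<^sub>h \<otimes> (v\<^sub>c v\<^sub>a - q\<^bsub>c,a\<^esub> v\<^sub>e v\<^sub>c)\<close>, a multiple of \<open>v\<^sub>h \<otimes> v\<^sub>a v\<^sub>e\<close>
  (or zero) by the degree two relation of \<open>v\<^sub>c v\<^sub>a\<close>, because \<open>e = c \<triangleright> a\<close>.
  For the second claim, the Hurwitz orbit of \<open>(c,b,a)\<close> is regular for
  \<open>SL(2,3)\<close> unless \<open>d = a\<close> and \<open>e = b\<close>, and none of the words whose quantum symmetrization involves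
  \<open>cba\<close> lies in \<open>{a,b,d,e}\<^sup>3\<close>.\<close>

section \<open>Linear extension from words\<close>

text \<open>All computations take place in T(V), with subspaces of B(V) replaced by their preimages.
  The obstacle to checking the coideal property on generators only is the braided product: in (P
  \<otimes> R)(P' \<otimes> R') every word of R acts on P', so in general the result is a pure
  tensor only if all words of R act alike. Right factors are therefore taken from the homogeneous
  elements of the subalgebra, a set closed under products but not under sums. The sign that makes
  degree (1,2) work comes from slimness: on a noncommuting pair c_q permutes three words cyclically
  up to scalars, and (1 + c)(1 - c + c^2) = 1 + c^3, so the product of the three cocycle values is
  -1. This is used for h, e, d, the c-translates of b, a, b \<triangleright> a. Moreover c_1c_2
  brings a transformed last letter to the front, so d \<otimes> cb and e \<otimes> dc occur twice in
  the coproduct of Z with opposite signs. In the second claim the separating functional is the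
  coefficient of cba in the quantum symmetrization. A word over a, b, d, e could contribute only
  through a letter c, c \<triangleright> b or b \<triangleright> a, or a last letter z with a
  \<triangleright> z = c \<triangleright> b.\<close>

abbreviation fsupp :: "('a \<Rightarrow> 'k::zero) \<Rightarrow> bool" where
  "fsupp f \<equiv> finite (supp f)"

text \<open>Linearity is demanded on finite supports only: \<open>lext\<close> sums over
  \<open>supp f\<close>, and such a sum takes the default value 0 when the support is
  infinite.\<close>

definition lin :: "(('a \<Rightarrow> 'k::comm_ring_1) \<Rightarrow> 'b \<Rightarrow> 'k) \<Rightarrow> bool" where
  "lin F \<longleftrightarrow> (\<forall>f. fsupp f \<longrightarrow> fsupp (F f)) \<and>
     (\<forall>f g k. fsupp f \<longrightarrow> fsupp g \<longrightarrow> F (\<lambda>w. f w + k * g w) = (\<lambda>w. F f w + k * F g w))"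

definition subsp :: "('a \<Rightarrow> 'k::comm_ring_1) set \<Rightarrow> bool" where
  "subsp M \<longleftrightarrow> (\<lambda>_. 0) \<in> M \<and> (\<forall>f\<in>M. \<forall>g\<in>M. \<forall>k. (\<lambda>w. f w + k * g w) \<in> M)"

lemma supp_wd: "supp (wd u :: 'a \<Rightarrow> 'k::comm_ring_1) = {u}"
  by (auto simp: supp_def wd_def)

lemma fsupp_wd [simp]: "fsupp (wd u :: 'a \<Rightarrow> 'k::comm_ring_1)"
  by (simp add: supp_wd)

lemma supp_zero [simp]: "supp (\<lambda>_. 0) = {}"
  by (simp add: supp_def)

lemma supp_lincomb: "supp (\<lambda>w. f w + k * g w) \<subseteq> supp f \<union> supp (g :: 'a \<Rightarrow> 'k::comm_ring_1)"
  by (auto simp: supp_def)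

lemma supp_add: "supp (\<lambda>w. f w + g w) \<subseteq> supp f \<union> supp (g :: 'a \<Rightarrow> 'k::comm_ring_1)"
  by (auto simp: supp_def)

lemma supp_smult: "supp (\<lambda>w. k * f w) \<subseteq> supp (f :: 'a \<Rightarrow> 'k::comm_ring_1)"
  by (auto simp: supp_def)

lemma fsupp_lincomb [simp]:
  "fsupp f \<Longrightarrow> fsupp g \<Longrightarrow> fsupp (\<lambda>w. f w + k * (g w :: 'k::comm_ring_1))"
  by (rule finite_subset[OF supp_lincomb]) simp

lemma fsupp_add [simp]: "fsupp f \<Longrightarrow> fsupp g \<Longrightarrow> fsupp (\<lambda>w. f w + (g w :: 'k::comm_ring_1))"
  by (rule finite_subset[OF supp_add]) simp

lemma fsupp_smult [simp]: "fsupp f \<Longrightarrow> fsupp (\<lambda>w. k * (f w :: 'k::comm_ring_1))"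
  by (rule finite_subset[OF supp_smult])

lemma fsupp_if [simp]: "fsupp f \<Longrightarrow> fsupp (\<lambda>w. if P w then f w else (0::'k::comm_ring_1))"
  by (erule rev_finite_subset) (auto simp: supp_def)

lemma fsupp_sum [simp]:
  "finite K \<Longrightarrow> (\<And>i. i \<in> K \<Longrightarrow> fsupp (f i)) \<Longrightarrow> fsupp (\<lambda>w. \<Sum>i\<in>K. (f i w :: 'k::comm_ring_1))"
  by (induction K rule: finite_induct) auto

lemma fin_induct [consumes 2, case_names zero step]:
  fixes f :: "'a \<Rightarrow> 'k::comm_ring_1"
  assumes "fsupp f" "supp f \<subseteq> A" and z: "P (\<lambda>_. 0)"
    and s: "\<And>f k u. u \<in> A \<Longrightarrow> fsupp f \<Longrightarrow> supp f \<subseteq> A \<Longrightarrow> P f \<Longrightarrow> P (\<lambda>w. f w + k * wd u w)"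
  shows "P f"
proof -
  have "finite B \<Longrightarrow> supp f \<subseteq> B \<Longrightarrow> supp f \<subseteq> A \<Longrightarrow> P f" for B
  proof (induction B arbitrary: f rule: finite_induct)
    case empty
    then have "f = (\<lambda>_. 0)" by (auto simp: supp_def)
    then show ?case using z by simp
  next
    case (insert u B)
    show ?case
    proof (cases "u \<in> supp f")
      case True
      let ?g = "f(u := 0)"
      have sg: "supp ?g \<subseteq> B" "supp ?g \<subseteq> A"
        using insert.prems by (auto simp: supp_def)
      then have "fsupp ?g" using insert.hyps finite_subset by blast
      have "P (\<lambda>w. ?g w + f u * wd u w)"
        using insert.IH[OF sg(1,2)] s[of u ?g "f u"] sg \<open>fsupp ?g\<close> True insert.prems by blast
      moreover have "(\<lambda>w. ?g w + f u * wd u w) = f" by (auto simp: wd_def)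
      ultimately show ?thesis by simp
    next
      case False
      then show ?thesis using insert by blast
    qed
  qed
  then show ?thesis using assms by blast
qed

lemma lin_fsupp: "lin F \<Longrightarrow> fsupp f \<Longrightarrow> fsupp (F f)"
  by (simp add: lin_def)

lemma lin_lincomb:
  "lin F \<Longrightarrow> fsupp f \<Longrightarrow> fsupp g \<Longrightarrow> F (\<lambda>w. f w + k * g w) = (\<lambda>w. F f w + k * F g w)"
  by (simp add: lin_def)

lemma lin_add:
  "lin F \<Longrightarrow> fsupp f \<Longrightarrow> fsupp g \<Longrightarrow> F (\<lambda>w. f w + g w) = (\<lambda>w. F f w + F g w)"
  using lin_lincomb[of F f g 1] by simp

lemma lin_zero: "lin F \<Longrightarrow> F (\<lambda>_. 0) = (\<lambda>_. 0)"
  using lin_add[of F "\<lambda>_. 0" "\<lambda>_. 0"] by (auto simp: fun_eq_iff)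

lemma lin_smult: "lin F \<Longrightarrow> fsupp f \<Longrightarrow> F (\<lambda>w. k * f w) = (\<lambda>w. k * F f w)"
  using lin_lincomb[of F "\<lambda>_. 0" f k] lin_zero[of F] by simp

lemma lin_diff:
  "lin F \<Longrightarrow> fsupp f \<Longrightarrow> fsupp g \<Longrightarrow> F (\<lambda>w. f w - g w) = (\<lambda>w. F f w - F g w)"
  using lin_lincomb[of F f g "-1"] by simp

lemma lin_sum:
  assumes "lin F" "finite K" "\<And>i. i \<in> K \<Longrightarrow> fsupp (f i)"
  shows "F (\<lambda>w. \<Sum>i\<in>K. f i w) = (\<lambda>w. \<Sum>i\<in>K. F (f i) w)"
  using assms(2,3)
  by (induction K rule: finite_induct)
     (auto simp: lin_zero[OF assms(1)] lin_add[OF assms(1)])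

lemma lin_ext:
  assumes "lin F" "lin G" "\<And>u. u \<in> A \<Longrightarrow> F (wd u) = G (wd u)" "fsupp f" "supp f \<subseteq> A"
  shows "F f = G f"
  using assms(4,5)
  by (induction rule: fin_induct)
     (simp_all add: lin_zero[OF assms(1)] lin_zero[OF assms(2)] lin_lincomb[OF assms(1)]
        lin_lincomb[OF assms(2)] assms(3))

lemma lin_ext_UNIV:
  assumes "lin F" "lin G" "\<And>u. F (wd u) = G (wd u)" "fsupp f"
  shows "F f = G f"
  using lin_ext[OF assms(1,2), of UNIV] assms by simp

lemma lin_subsp:
  assumes "lin F" "subsp M" "\<And>u. u \<in> A \<Longrightarrow> F (wd u) \<in> M" "fsupp f" "supp f \<subseteq> A"
  shows "F f \<in> M"
  using assms(4,5)
proof (induction rule: fin_induct)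
  case zero
  then show ?case using assms(1,2) by (simp add: lin_zero subsp_def)
next
  case (step f k u)
  then show ?case using assms(1-3) by (simp add: lin_lincomb subsp_def)
qed

lemma lin_id [intro]: "lin (\<lambda>f. f)"
  by (simp add: lin_def)

lemma lin_comp [intro]: "lin F \<Longrightarrow> lin G \<Longrightarrow> lin (\<lambda>f. F (G f))"
  by (auto simp: lin_def)

lemma lin_plus [intro]: "lin F \<Longrightarrow> lin G \<Longrightarrow> lin (\<lambda>f w. F f w + G f w)"
  unfolding lin_def by (auto simp: algebra_simps)

lemma lin_scale [intro]: "lin F \<Longrightarrow> lin (\<lambda>f w. k * F f w)"
  unfolding lin_def by (auto simp: algebra_simps)

lemma lin_null [intro]: "lin (\<lambda>f w. 0)"
  by (simp add: lin_def)

lemma lin_sums [intro]: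
  assumes "finite K" "\<And>i. i \<in> K \<Longrightarrow> lin (F i)" shows "lin (\<lambda>f w. \<Sum>i\<in>K. F i f w)"
  using assms by (induction K rule: finite_induct) (auto intro!: lin_plus)

lemma lin_restrict [intro]: "lin (\<lambda>f w. if P w then f w else 0)"
  unfolding lin_def by (auto simp: fun_eq_iff)

lemma lext_superset:
  assumes "finite A" "supp f \<subseteq> A"
  shows "lext B f = (\<lambda>w. \<Sum>u\<in>A. f u * B u w)"
  unfolding lext_def
  by (rule ext, rule sum.mono_neutral_left) (use assms in \<open>auto simp: supp_def\<close>)

lemma lext_wd [simp]: "lext B (wd u) = B u"
  unfolding lext_def by (simp add: supp_wd) (simp add: wd_def)

lemma lin_lext [intro]:
  fixes B :: "'a \<Rightarrow> 'b \<Rightarrow> 'c::comm_ring_1"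
  assumes "\<And>u. fsupp (B u)"
  shows "lin (lext B)"
  unfolding lin_def
proof (intro conjI allI impI)
  fix f :: "'a \<Rightarrow> 'c" assume "fsupp f"
  then show "fsupp (lext B f)" unfolding lext_def using assms by simp
next
  fix f g :: "'a \<Rightarrow> 'c" and k assume f: "fsupp f" and g: "fsupp g"
  let ?A = "supp f \<union> supp g"
  have "lext B (\<lambda>w. f w + k * g w) = (\<lambda>w. \<Sum>u\<in>?A. (f u + k * g u) * B u w)"
    by (rule lext_superset) (use f g supp_lincomb[of f k g] in auto)
  moreover have "lext B f = (\<lambda>w. \<Sum>u\<in>?A. f u * B u w)"
    by (rule lext_superset) (use f g in auto)
  moreover have "lext B g = (\<lambda>w. \<Sum>u\<in>?A. g u * B u w)"
    by (rule lext_superset) (use f g in auto)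
  ultimately show "lext B (\<lambda>w. f w + k * g w) = (\<lambda>w. lext B f w + k * lext B g w)"
    by (simp add: sum.distrib sum_distrib_left algebra_simps)
qed

lemma subspD:
  assumes "subsp M"
  shows subsp_zero: "(\<lambda>_. 0) \<in> M"
    and subsp_lincomb: "f \<in> M \<Longrightarrow> g \<in> M \<Longrightarrow> (\<lambda>w. f w + k * g w) \<in> M"
  using assms by (auto simp: subsp_def)

lemma subsp_add: "subsp M \<Longrightarrow> f \<in> M \<Longrightarrow> g \<in> M \<Longrightarrow> (\<lambda>w. f w + g w) \<in> M"
  using subsp_lincomb[of M f g 1] by simp

lemma subsp_smult: "subsp M \<Longrightarrow> f \<in> M \<Longrightarrow> (\<lambda>w. k * f w) \<in> M"
  using subsp_lincomb[of M "\<lambda>_. 0" f k] subsp_zero[of M] by simp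

lemma subsp_diff: "subsp M \<Longrightarrow> f \<in> M \<Longrightarrow> g \<in> M \<Longrightarrow> (\<lambda>w. f w - g w) \<in> M"
  using subsp_lincomb[of M f g "-1"] by simp

lemma subsp_sum:
  assumes "subsp M" "finite K" "\<And>i. i \<in> K \<Longrightarrow> f i \<in> M"
  shows "(\<lambda>w. \<Sum>i\<in>K. f i w) \<in> M"
  using assms(2,3)
  by (induction K rule: finite_induct) (auto intro: subsp_zero subsp_add assms(1))

lemma supp_tmul: "supp (tmul f g) \<subseteq> (\<lambda>(u, v). u @ v) ` (supp f \<times> supp g)"
proof
  fix w assume "w \<in> supp (tmul f g)"
  then obtain i where "f (take i w) * g (drop i w) \<noteq> 0"
    unfolding supp_def tmul_def by (auto elim: sum.not_neutral_contains_not_neutral)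
  then have "(take i w, drop i w) \<in> supp f \<times> supp g" by (auto simp: supp_def)
  then show "w \<in> (\<lambda>(u, v). u @ v) ` (supp f \<times> supp g)"
    by (metis (mono_tags, lifting) append_take_drop_id case_prod_conv image_eqI)
qed

lemma fsupp_tmul [simp]: "fsupp f \<Longrightarrow> fsupp g \<Longrightarrow> fsupp (tmul f g)"
  by (rule finite_subset[OF supp_tmul]) simp

lemma lin_tmul_right [intro]: "fsupp f \<Longrightarrow> lin (tmul f)"
  unfolding lin_def by (simp add: tmul_def[of _ "\<lambda>w. _ w + _ w"], simp add: tmul_def sum.distrib sum_distrib_left algebra_simps)

lemma lin_tmul_left [intro]: "fsupp g \<Longrightarrow> lin (\<lambda>f. tmul f g)"
  unfolding lin_def by (simp add: tmul_def[of "\<lambda>w. _ w + _ w"], simp add: tmul_def sum.distrib sum_distrib_left algebra_simps)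

lemma tmul_wd: "tmul (wd u) (wd v) = (wd (u @ v) :: _ \<Rightarrow> 'k::comm_ring_1)"
proof
  fix w :: "'a list"
  have "(\<Sum>i\<le>length w. wd u (take i w) * wd v (drop i w)) =
      (\<Sum>i\<le>length w. if i = length u then (if w = u @ v then 1 else 0) else (0::'k))"
  proof (rule sum.cong)
    fix i assume "i \<in> {..length w}"
    then have "take i w = u \<and> drop i w = v \<longleftrightarrow> i = length u \<and> w = u @ v"
      by (metis append_eq_conv_conj append_take_drop_id atMost_iff length_take min.absorb2)
    moreover have "wd u (take i w) * wd v (drop i w) =
        (if take i w = u \<and> drop i w = v then 1 else (0::'k))"
      by (simp add: wd_def)
    ultimately show "wd u (take i w) * wd v (drop i w) =
        (if i = length u then (if w = u @ v then 1 else 0) else (0::'k))"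
      by presburger
  qed simp
  also have "\<dots> = wd (u @ v) w" by (auto simp: wd_def)
  finally show "tmul (wd u) (wd v) w = (wd (u @ v) w :: 'k)" by (simp add: tmul_def)
qed

lemma tmul_wd_Nil [simp]: "tmul (wd []) f = (f :: _ \<Rightarrow> 'k::comm_ring_1)"
proof
  fix w :: "'a list"
  have "(\<Sum>i\<le>length w. wd [] (take i w) * f (drop i w)) =
      (\<Sum>i\<le>length w. if i = 0 then f w else (0::'k))"
    by (rule sum.cong) (auto simp: wd_def)
  then show "tmul (wd []) f w = f w" by (simp add: tmul_def)
qed

lemma tmul_Nil [simp]: "tmul f g [] = f [] * g []"
  by (simp add: tmul_def)

lemma lin_braid [intro]: "lin (braid act q i)"
  unfolding braid_def
proof (rule lin_lext)
  fix u :: "'a list"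
  have "supp (braid_word act q i u) \<subseteq> {u, u[i := act (u!i) (u!Suc i), Suc i := u!i]}"
    by (auto simp: supp_def braid_word_def wd_def split: if_splits)
  then show "fsupp (braid_word act q i u)" by (rule finite_subset) simp
qed

section \<open>Skew derivations and quantum symmetrizers\<close>

lemma tmul_letter:
  fixes f :: "'a list \<Rightarrow> 'k::comm_ring_1"
  shows "tmul (wd [x]) f [] = 0" "tmul (wd [x]) f (z # w) = (if z = x then f w else 0)"
proof -
  show "tmul (wd [x]) f [] = 0" by (simp add: wd_def)
  have "(\<Sum>i\<le>length (z # w). wd [x] (take i (z # w)) * f (drop i (z # w))) =
    (\<Sum>i\<le>length (z # w). if i = 1 then (if z = x then f w else 0) else 0)"
    by (rule sum.cong) (auto simp: wd_def take_Cons split: nat.splits)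
  also have "\<dots> = (if z = x then f w else 0)" by (subst sum.delta) simp_all
  finally show "tmul (wd [x]) f (z # w) = (if z = x then f w else 0)" by (simp only: tmul_def)
qed

lemma lin_hom [intro]: "lin (hom n)"
  unfolding hom_def by (rule lin_restrict)

lemma hom_wd: "hom n (wd u) = (if length u = n then wd u else (\<lambda>_. 0))"
  by (auto simp: hom_def wd_def)

lemma inj_snoc: "inj (\<lambda>w. w @ [y])"
  by (simp add: inj_on_def)

lemma lin_last [intro]: "lin (\<lambda>f w. f (w @ [y]) :: 'k::comm_ring_1)"
proof -
  have "fsupp (\<lambda>w. f (w @ [y]))" if "fsupp f" for f :: "'a list \<Rightarrow> 'k"
  proof -
    have "supp (\<lambda>w. f (w @ [y])) = (\<lambda>w. w @ [y]) -` supp f" by (auto simp: supp_def)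
    then show ?thesis using finite_vimageI[OF that inj_snoc] by simp
  qed
  then show ?thesis by (auto simp: lin_def)
qed

lemma supp_append_letter: "supp (append_letter g x) = (\<lambda>w. w @ [x]) ` supp g"
proof
  show "supp (append_letter g x) \<subseteq> (\<lambda>w. w @ [x]) ` supp g"
  proof
    fix w assume "w \<in> supp (append_letter g x)"
    then have "w = butlast w @ [x]" "butlast w \<in> supp g"
      by (auto simp: supp_def append_letter_def split: if_splits)
    then show "w \<in> (\<lambda>w. w @ [x]) ` supp g" by blast
  qed
qed (auto simp: supp_def append_letter_def)

lemma lin_on_init: "lin F \<Longrightarrow> lin (on_init F)"
  unfolding on_init_def
  by (rule lin_lext) (simp add: supp_append_letter lin_fsupp)

lemma on_init_Nil: "g [] = 0 \<Longrightarrow> on_init F g [] = 0"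
  unfolding on_init_def lext_def
  by (rule sum.neutral) (auto simp: append_letter_def supp_def)

text \<open>The last letter is a spectator. The hypothesis \<open>g [] = 0\<close> excludes the
  default case of \<open>on_init\<close>, which fixes the empty word because it has no last
  letter.\<close>

lemma on_init_snoc:
  assumes F: "lin F" and g: "fsupp g" "g [] = 0"
  shows "on_init F g (w @ [y]) = F (\<lambda>v. g (v @ [y])) w"
proof -
  have "(\<lambda>w. on_init F g (w @ [y])) = F (\<lambda>v. g (v @ [y]))"
  proof (rule lin_ext[OF lin_comp[OF lin_last lin_on_init[OF F]] lin_comp[OF F lin_last],
        where A = "{u. u \<noteq> []}"])
    fix u :: "'a list" assume "u \<in> {u. u \<noteq> []}"
    then obtain v x where u: "u = v @ [x]" by (cases u rule: rev_cases) auto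
    have "(\<lambda>v'. wd (v @ [x]) (v' @ [y]) :: 'b) = (if x = y then wd v else (\<lambda>_. 0))"
      by (auto simp: wd_def)
    then show "(\<lambda>w. on_init F (wd u) (w @ [y])) = F (\<lambda>v. wd u (v @ [y]))"
      using u lin_zero[OF F] by (auto simp: on_init_def append_letter_def)
  qed (use g in \<open>auto simp: supp_def\<close>)
  then show ?thesis by (rule fun_cong)
qed

locale braiding =
  fixes act :: "'x \<Rightarrow> 'x \<Rightarrow> 'x" and q :: "'x \<Rightarrow> 'x \<Rightarrow> 'k::field"
begin

definition qc :: "'x \<Rightarrow> 'x list \<Rightarrow> 'k" where
  "qc y u = prod_list (map (q y) u)"

text \<open>The right skew derivation of the tensor algebra dual to the letter \<open>y\<close>; its values are the
  components of the coproduct in \<open>T(V) \<otimes> V\<close>.\<close>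

primrec deriv_word :: "'x \<Rightarrow> 'x list \<Rightarrow> 'x list \<Rightarrow> 'k" where
  "deriv_word y [] = (\<lambda>_. 0)"
| "deriv_word y (x # u) = (\<lambda>w. tmul (wd [x]) (deriv_word y u) w
     + (if x = y then qc y u else 0) * wd (map (act y) u) w)"

definition deriv :: "'x \<Rightarrow> ('x list \<Rightarrow> 'k) \<Rightarrow> 'x list \<Rightarrow> 'k" where
  "deriv y = lext (deriv_word y)"

text \<open>This is the action of the group element g_y on T(V). Equivalently, it is what a word
  undergoes when the letter \<open>y\<close> is braided past it from left to right.\<close>

definition gact :: "'x \<Rightarrow> ('x list \<Rightarrow> 'k) \<Rightarrow> 'x list \<Rightarrow> 'k" where
  "gact y = lext (\<lambda>u w. qc y u * wd (map (act y) u) w)"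

text \<open>The head of the list is applied first. As each derivation removes a last letter, the
  list is the reversal of the word whose coefficient is extracted.\<close>

primrec derivs :: "'x list \<Rightarrow> ('x list \<Rightarrow> 'k) \<Rightarrow> 'x list \<Rightarrow> 'k" where
  "derivs [] f = f"
| "derivs (y # w) f = derivs w (deriv y f)"

lemma qc_simps [simp]: "qc y [] = 1" "qc y (x # u) = q y x * qc y u" "qc y (u @ v) = qc y u * qc y v"
  by (simp_all add: qc_def)

lemma fsupp_deriv_word [simp]: "fsupp (deriv_word y u)"
  by (induction u) simp_all

lemma lin_deriv [intro]: "lin (deriv y)"
  unfolding deriv_def by (rule lin_lext) simp

lemma deriv_wd [simp]: "deriv y (wd u) = deriv_word y u"
  by (simp add: deriv_def)

lemma lin_gact [intro]: "lin (gact y)"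
  unfolding gact_def by (rule lin_lext) simp

lemma gact_wd: "gact y (wd u) = (\<lambda>w. qc y u * wd (map (act y) u) w)"
  by (simp add: gact_def)

lemma lin_derivs [intro]: "lin (derivs w)"
proof (induction w)
  case (Cons y w)
  then show ?case using lin_comp[OF Cons lin_deriv] by simp
qed (simp add: lin_id)

lemma braid_letters:
  "braid act q (length p) (wd (p @ x # y # t)) = (\<lambda>w. q x y * wd (p @ act x y # x # t) w)"
  unfolding braid_def lext_wd
  by (auto simp: braid_word_def nth_append list_update_append wd_def)

text \<open>The letter \<open>x\<close> crosses \<open>s\<close> one letter at a time. Induction
  from the right fits because the last letter of \<open>s\<close> is crossed last, at position
  \<open>length p + length s - 1\<close>.\<close>

lemma fold_braid:
  "fold (braid act q) [length p..<length p + length s] (wd (p @ x # s @ t)) =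
    (\<lambda>w. qc x s * wd (p @ map (act x) s @ x # t) w)"
proof (induction s arbitrary: t rule: rev_induct)
  case (snoc y s)
  have "fold (braid act q) [length p..<length p + length (s @ [y])] (wd (p @ x # (s @ [y]) @ t)) =
      braid act q (length p + length s) (\<lambda>w. qc x s * wd (p @ map (act x) s @ x # y # t) w)"
    using snoc[of "y # t"] by simp
  also have "\<dots> = (\<lambda>w. qc x s * braid act q (length (p @ map (act x) s))
      (wd ((p @ map (act x) s) @ x # y # t)) w)"
    by (subst lin_smult[OF lin_braid]) simp_all
  finally show ?case by (simp only: braid_letters) (simp add: mult.assoc)
qed simp

lemma braid_chain_fold: "braid_chain act q m j = fold (braid act q) [m - 1 - j..<m - 1]"
proof -
  have "foldr (\<circ>) (map F xs) id = foldr F xs" for F :: "nat \<Rightarrow> ('x list \<Rightarrow> 'k) \<Rightarrow> 'x list \<Rightarrow> 'k" and xs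
    by (induction xs) auto
  then show ?thesis by (simp add: braid_chain_def foldr_conv_fold)
qed

text \<open>The second index of \<open>braid_chain\<close> counts crossings. With
  \<open>length u - Suc i\<close> of them the chain starts at position \<open>i\<close> and carries
  that letter to the end.\<close>

lemma braid_chain_word:
  assumes "i < length u"
  shows "braid_chain act q (length u) (length u - Suc i) (wd u) =
    (\<lambda>w. qc (u!i) (drop (Suc i) u) * wd (take i u @ map (act (u!i)) (drop (Suc i) u) @ [u!i]) w)"
proof -
  have "length u - 1 - (length u - Suc i) = i" using assms by auto
  then show ?thesis
    using fold_braid[of "take i u" "drop (Suc i) u" "u!i" "[]"] assms
    by (simp add: braid_chain_fold id_take_nth_drop[symmetric])
qed

text \<open>Unrolling the recursion, each occurrence of \<open>y\<close> is braided to the end of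
  the word and then deleted.\<close>

lemma deriv_word_sum:
  "deriv_word y u = (\<lambda>w. \<Sum>i<length u. if u!i = y
     then qc y (drop (Suc i) u) * wd (take i u @ map (act y) (drop (Suc i) u)) w else 0)"
proof (induction u)
  case (Cons x u)
  have [simp]: "lin (tmul (wd [x] :: _ \<Rightarrow> 'k))" by (rule lin_tmul_right) simp
  have "tmul (wd [x]) (deriv_word y u) = (\<lambda>w. \<Sum>i<length u. tmul (wd [x]) (\<lambda>w. if u!i = y
     then qc y (drop (Suc i) u) * wd (take i u @ map (act y) (drop (Suc i) u)) w else 0) w)"
    by (subst Cons, rule lin_sum) auto
  also have "\<dots> = (\<lambda>w. \<Sum>i<length u. if u!i = y
     then qc y (drop (Suc i) u) * wd (x # take i u @ map (act y) (drop (Suc i) u)) w else 0)"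
    by (rule ext, rule sum.cong) (auto simp: lin_smult tmul_wd lin_zero)
  finally show ?case
    by (simp add: sum.lessThan_Suc_shift add.commute fun_eq_iff cong: if_cong
          del: sum.lessThan_Suc drop_Suc_Cons[symmetric])
qed simp

lemma lin_braid_chain: "lin (braid_chain act q m j)"
proof -
  have "lin (fold (braid act q) xs)" for xs
  proof (induction xs)
    case (Cons i xs)
    then show ?case using lin_comp[OF Cons lin_braid[of act q i]] by (simp add: comp_def)
  qed (simp add: id_def lin_id)
  then show ?thesis by (simp add: braid_chain_fold)
qed

lemma lin_Tsh: "lin (Tsh act q m)"
  unfolding Tsh_def by (rule lin_sums) (auto intro: lin_braid_chain)

lemma Tsh_word:
  assumes "length u = Suc n"
  shows "Tsh act q (Suc n) (wd u) = (\<lambda>w. if w = [] then 0 else deriv_word (last w) u (butlast w))"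
proof
  fix w
  let ?g = "\<lambda>i. qc (u!i) (drop (Suc i) u) * wd (take i u @ map (act (u!i)) (drop (Suc i) u) @ [u!i]) w"
  \<comment> \<open>Reversing the order of summation replaces the number of crossings by the
    position of the letter that moves.\<close>
  have "Tsh act q (Suc n) (wd u) w = (\<Sum>j<Suc n. braid_chain act q (Suc n) (Suc n - Suc j) (wd u) w)"
    unfolding Tsh_def by (rule sum.nat_diff_reindex[symmetric])
  also have "\<dots> = (\<Sum>i<Suc n. ?g i)"
    by (rule sum.cong) (use braid_chain_word[of _ u] assms in simp_all)
  also have "\<dots> = (if w = [] then 0 else deriv_word (last w) u (butlast w))"
  proof (cases w rule: rev_cases)
    case Nil
    then show ?thesis by (auto simp: wd_def intro: sum.neutral)
  next
    case (snoc v y)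
    then show ?thesis
      by (simp add: deriv_word_sum assms del: sum.lessThan_Suc)
         (rule sum.cong, auto simp: wd_def)
  qed
  finally show "Tsh act q (Suc n) (wd u) w = (if w = [] then 0 else deriv_word (last w) u (butlast w))" .
qed

lemma Tsh_deriv:
  assumes "fsupp f" "supp f \<subseteq> {u. length u = Suc n}"
  shows "Tsh act q (Suc n) f (w @ [y]) = deriv y f w" "Tsh act q (Suc n) f [] = 0"
proof -
  have "(\<lambda>w. Tsh act q (Suc n) f (w @ [y])) = deriv y f"
    by (rule lin_ext[OF lin_comp[OF lin_last lin_Tsh] lin_deriv _ assms]) (simp add: Tsh_word)
  then show "Tsh act q (Suc n) f (w @ [y]) = deriv y f w" by (rule fun_cong)
  \<comment> \<open>A value at the empty word is wrapped as a function supported there, so that the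
    comparison of linear operators on words applies. The same device recurs below.\<close>
  have "(\<lambda>w. if w = [] then Tsh act q (Suc n) f w else 0) = (\<lambda>w. 0)"
    by (rule lin_ext[OF lin_comp[OF lin_restrict lin_Tsh] lin_null _ assms])
       (auto simp: Tsh_word)
  then show "Tsh act q (Suc n) f [] = 0" by metis
qed

lemma lin_qsym: "lin (qsym act q n)"
proof (induction n)
  case (Suc n)
  then show ?case using lin_comp[OF lin_on_init[OF Suc] lin_Tsh] by simp
qed (simp add: lin_id)

lemma supp_deriv_word: "supp (deriv_word y u) \<subseteq> {w. Suc (length w) = length u}"
proof
  fix w assume "w \<in> supp (deriv_word y u)"
  then have "(\<Sum>i<length u. if u!i = y
     then qc y (drop (Suc i) u) * wd (take i u @ map (act y) (drop (Suc i) u)) w else 0) \<noteq> 0"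
    by (subst (asm) deriv_word_sum) (simp add: supp_def)
  then obtain i where "i < length u" "w = take i u @ map (act y) (drop (Suc i) u)"
    by (fastforce elim: sum.not_neutral_contains_not_neutral simp: wd_def split: if_splits)
  then show "w \<in> {w. Suc (length w) = length u}" by simp
qed

lemma deriv_hom:
  assumes "fsupp f" shows "deriv y (hom (Suc n) f) = hom n (deriv y f)"
proof (rule lin_ext_UNIV[OF lin_comp[OF lin_deriv lin_hom] lin_comp[OF lin_hom lin_deriv] _ assms])
  fix u
  show "deriv y (hom (Suc n) (wd u)) = hom n (deriv y (wd u))"
    using supp_deriv_word[of y u] lin_zero[OF lin_deriv, of y]
    by (cases "length u = Suc n") (auto simp: hom_wd hom_def[of n "deriv_word y u"]
      hom_def[of n "\<lambda>_. 0"] supp_def fun_eq_iff)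
qed

lemma derivs_hom:
  "fsupp f \<Longrightarrow> derivs w (hom (length w) f) [] = derivs w f []"
proof (induction w arbitrary: f)
  case (Cons y w)
  then show ?case using deriv_hom[of f y "length w"] lin_fsupp[OF lin_deriv, of f y] by simp
qed (simp add: hom_def)

text \<open>One step of \<open>qsym\<close> peels off the last letter \<open>y\<close> of
  \<open>w\<close>: by \<open>Tsh_deriv\<close> the part of \<open>Tsh\<close> ending in
  \<open>y\<close> is \<open>deriv y f\<close>, and the smaller symmetrizer acts on it. Hence
  \<open>w\<close> is read from right to left.\<close>

lemma qsym_derivs:
  assumes "fsupp f" "supp f \<subseteq> {u. length u = n}"
  shows "qsym act q n f w = (if length w = n then derivs (rev w) f [] else 0)"
  using assms
proof (induction n arbitrary: f w)
  case 0
  then show ?case by (auto simp: supp_def)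
next
  case (Suc n)
  have T: "fsupp (Tsh act q (Suc n) f)" "Tsh act q (Suc n) f [] = 0"
    using lin_fsupp[OF lin_Tsh] Tsh_deriv(2) Suc.prems by blast+
  show ?case
  proof (cases w rule: rev_cases)
    case Nil
    then show ?thesis using T by (simp add: on_init_Nil)
  next
    case (snoc v y)
    have "f = hom (Suc n) f" using Suc.prems(2) by (auto simp: hom_def supp_def fun_eq_iff)
    then have "deriv y f = hom n (deriv y f)" using deriv_hom Suc.prems(1) by metis
    then have "supp (deriv y f) \<subseteq> {u. length u = n}" by (auto simp: hom_def supp_def) metis
    then have "qsym act q n (deriv y f) v = (if length v = n then derivs (rev v) (deriv y f) [] else 0)"
      using Suc.IH lin_fsupp[OF lin_deriv] Suc.prems(1) by blast
    moreover have "(\<lambda>v. Tsh act q (Suc n) f (v @ [y])) = deriv y f"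
      using Tsh_deriv(1)[OF Suc.prems] by blast
    ultimately show ?thesis using T snoc by (simp add: on_init_snoc[OF lin_qsym])
  qed
qed

text \<open>The degree bookkeeping disappears, since \<open>derivs w\<close> evaluated at
  \<open>[]\<close> sees only the component of degree \<open>length w\<close>. From here on the
  symmetrizers are replaced by these functionals.\<close>

theorem nichols_zero_derivs:
  assumes "fsupp f"
  shows "nichols_zero act q f \<longleftrightarrow> (\<forall>w. derivs w f [] = 0)"
proof -
  have "qsym act q n (hom n f) w = (if length w = n then derivs (rev w) f [] else 0)" for n w
  proof -
    have "qsym act q n (hom n f) w = (if length w = n then derivs (rev w) (hom n f) [] else 0)"
      using assms by (intro qsym_derivs lin_fsupp[OF lin_hom]) (auto simp: hom_def supp_def)
    then show ?thesis using derivs_hom[OF assms, of "rev w"] by auto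
  qed
  then show ?thesis unfolding nichols_zero_def fun_eq_iff by (metis length_rev rev_rev_ident)
qed

end

section \<open>The defining ideal of the Nichols algebra\<close>

lemma tmul_Cons: "tmul f g (z # w) = f [] * g (z # w) + tmul (\<lambda>w. f (z # w)) g (w :: 'a list)"
  for f g :: "'a list \<Rightarrow> 'k::comm_ring_1"
  unfolding tmul_def by (simp add: sum.atMost_Suc_shift del: sum.atMost_Suc)

lemma tmul_letter_assoc:
  fixes f g :: "'a list \<Rightarrow> 'k::comm_ring_1"
  shows "tmul (tmul (wd [x]) f) g = tmul (wd [x]) (tmul f g)"
proof
  fix w
  show "tmul (tmul (wd [x]) f) g w = tmul (wd [x]) (tmul f g) w"
  proof (cases w)
    case (Cons z v)
    have "tmul (\<lambda>_. 0) g = (\<lambda>_. 0)" by (simp add: tmul_def)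
    then show ?thesis using Cons by (simp add: tmul_Cons[of "tmul (wd [x]) f"] tmul_letter)
        (simp add: wd_def)
  qed (simp add: tmul_letter)
qed

lemma tmul_wd_Cons:
  "tmul (wd (x # u)) f = (tmul (wd [x]) (tmul (wd u) f) :: 'a list \<Rightarrow> 'k::comm_ring_1)"
  using tmul_letter_assoc[of x "wd u" f] by (simp add: tmul_wd)

section \<open>Skew Leibniz rule and the group action on the tensor algebra\<close>

context braiding
begin

lemma deriv_word_append:
  "deriv_word y (u @ v) =
    (\<lambda>w. tmul (wd u) (deriv_word y v) w + tmul (deriv_word y u) (gact y (wd v)) w)"
proof (induction u)
  case Nil
  have "tmul (\<lambda>_. 0) (gact y (wd v)) = (\<lambda>_. 0)" by (simp add: tmul_def)
  then show ?case by simp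
next
  case (Cons x u)
  have fs: "fsupp (gact y (wd v))" by (rule lin_fsupp[OF lin_gact]) simp
  have 1: "tmul (wd (map (act y) u)) (gact y (wd v)) =
      (\<lambda>w. qc y v * wd (map (act y) (u @ v)) w)"
    unfolding gact_wd by (subst lin_smult[OF lin_tmul_right]) (simp_all add: tmul_wd)
  have 2: "tmul (deriv_word y (x # u)) (gact y (wd v)) = (\<lambda>w. tmul (wd [x]) (tmul (deriv_word y u) (gact y (wd v))) w
     + (if x = y then qc y u else 0) * (qc y v * wd (map (act y) (u @ v)) w))"
    unfolding deriv_word.simps
    by (subst lin_lincomb[OF lin_tmul_left]) (simp_all only: fs 1 tmul_letter_assoc fsupp_tmul fsupp_wd fsupp_deriv_word)
  have 3: "tmul (wd [x]) (deriv_word y (u @ v)) =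
      (\<lambda>w. tmul (wd (x # u)) (deriv_word y v) w + tmul (wd [x]) (tmul (deriv_word y u) (gact y (wd v))) w)"
    unfolding Cons by (subst lin_add[OF lin_tmul_right]) (simp_all add: fs tmul_wd_Cons[of x u])
  show ?case
  proof
    fix w
    have "deriv_word y ((x # u) @ v) w = tmul (wd [x]) (deriv_word y (u @ v)) w
        + (if x = y then qc y (u @ v) else 0) * wd (map (act y) (u @ v)) w" by simp
    then show "deriv_word y ((x # u) @ v) w =
        tmul (wd (x # u)) (deriv_word y v) w + tmul (deriv_word y (x # u)) (gact y (wd v)) w"
      unfolding 2 3 by simp
  qed
qed

text \<open>A letter taken from \<open>g\<close> only has to reach the end of \<open>g\<close>,
  while a letter taken from \<open>f\<close> must also pass all of \<open>g\<close>, which turns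
  \<open>g\<close> into \<open>gact y g\<close>.\<close>

lemma deriv_tmul:
  assumes "fsupp f" "fsupp g"
  shows "deriv y (tmul f g) = (\<lambda>w. tmul f (deriv y g) w + tmul (deriv y f) (gact y g) w)"
proof -
  have fs: "fsupp (gact y g)" "fsupp (deriv y g)"
    using assms(2) lin_fsupp[OF lin_gact] lin_fsupp[OF lin_deriv] by blast+
  have word: "deriv y (tmul (wd u) g) = (\<lambda>w. tmul (wd u) (deriv y g) w + tmul (deriv y (wd u)) (gact y g) w)" for u
  proof (rule lin_ext_UNIV[OF lin_comp[OF lin_deriv lin_tmul_right]
        lin_plus[OF lin_comp[OF lin_tmul_right lin_deriv] lin_comp[OF lin_tmul_right lin_gact]]])
  qed (use assms in \<open>simp_all add: tmul_wd deriv_word_append\<close>)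
  show ?thesis
    by (rule lin_ext_UNIV[OF lin_comp[OF lin_deriv lin_tmul_left]
        lin_plus[OF lin_tmul_left lin_comp[OF lin_tmul_left lin_deriv]]])
      (use assms word fs in simp_all)
qed

lemma gact_tmul_letter:
  assumes "fsupp f"
  shows "gact y (tmul (wd [x]) f) = (\<lambda>w. q y x * tmul (wd [act y x]) (gact y f) w)"
proof (rule lin_ext_UNIV[OF lin_comp[OF lin_gact lin_tmul_right]
      lin_scale[OF lin_comp[OF lin_tmul_right lin_gact]] _ assms])
  fix u
  show "gact y (tmul (wd [x]) (wd u)) = (\<lambda>w. q y x * tmul (wd [act y x]) (gact y (wd u)) w)"
    unfolding tmul_wd gact_wd by (subst lin_smult[OF lin_tmul_right]) (simp_all add: tmul_wd mult.assoc)
qed simp_all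

lemma gact_Nil: "fsupp f \<Longrightarrow> gact y f [] = f []"
proof -
  assume f: "fsupp f"
  have "(\<lambda>w. if w = [] then gact y f w else 0) = (\<lambda>w. if w = [] then f w else 0)"
    by (rule lin_ext_UNIV[OF lin_comp[OF lin_restrict lin_gact] lin_restrict _ f])
       (unfold gact_wd, auto simp: wd_def)
  then show ?thesis by metis
qed

end

locale rack_cocycle = braiding act q
  for act :: "'x \<Rightarrow> 'x \<Rightarrow> 'x" and q :: "'x \<Rightarrow> 'x \<Rightarrow> 'k::field" +
  fixes X :: "'x set"
  assumes act_closed: "x \<in> X \<Longrightarrow> y \<in> X \<Longrightarrow> act x y \<in> X"
    and act_dist: "x \<in> X \<Longrightarrow> y \<in> X \<Longrightarrow> z \<in> X \<Longrightarrow> act (act x y) (act x z) = act x (act y z)"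
    and act_inj: "x \<in> X \<Longrightarrow> y \<in> X \<Longrightarrow> z \<in> X \<Longrightarrow> act x y = act x z \<Longrightarrow> y = z"
    and act_surj: "x \<in> X \<Longrightarrow> y \<in> X \<Longrightarrow> \<exists>z\<in>X. act x z = y"
    and cocycle: "x \<in> X \<Longrightarrow> y \<in> X \<Longrightarrow> z \<in> X \<Longrightarrow>
      q (act x y) (act x z) * q x z = q x (act y z) * q y z"
begin

definition TV :: "('x list \<Rightarrow> 'k) set" where
  "TV = {f. fsupp f \<and> supp f \<subseteq> lists X}"

text \<open>The defining ideal inside the tensor algebra on letters from \<open>X\<close>. The word
  \<open>w\<close> ranges over all letters of the type; those outside \<open>X\<close> impose
  nothing, by \<open>deriv_outside\<close>.\<close>

definition NI :: "('x list \<Rightarrow> 'k) set" where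
  "NI = {f \<in> TV. \<forall>w. derivs w f [] = 0}"

lemma TV_fsupp: "f \<in> TV \<Longrightarrow> fsupp f"
  by (simp add: TV_def)

lemma wd_TV [simp]: "wd u \<in> TV \<longleftrightarrow> u \<in> lists X"
  by (simp add: TV_def supp_wd del: in_lists_conv_set)

lemma subsp_TV: "subsp TV"
proof -
  have "supp (\<lambda>w. f w + k * g w) \<subseteq> lists X" if "supp f \<subseteq> lists X" "supp g \<subseteq> lists X"
    for f g :: "'x list \<Rightarrow> 'k" and k
    using supp_lincomb[of f k g] that by blast
  then show ?thesis by (simp add: TV_def subsp_def)
qed

lemma TV_lin:
  "lin F \<Longrightarrow> (\<And>u. u \<in> lists X \<Longrightarrow> F (wd u) \<in> M) \<Longrightarrow> subsp M \<Longrightarrow> f \<in> TV \<Longrightarrow> F f \<in> M"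
  by (rule lin_subsp[of F M "lists X"]) (auto simp: TV_def)

lemma TV_ext:
  "lin F \<Longrightarrow> lin G \<Longrightarrow> (\<And>u. u \<in> lists X \<Longrightarrow> F (wd u) = G (wd u)) \<Longrightarrow> f \<in> TV \<Longrightarrow> F f = G f"
  by (rule lin_ext[of F G "lists X"]) (auto simp: TV_def)

lemma NI_TV: "f \<in> NI \<Longrightarrow> f \<in> TV"
  by (simp add: NI_def)

lemma NI_iff: "f \<in> NI \<longleftrightarrow> f \<in> TV \<and> nichols_zero act q f"
  unfolding NI_def using nichols_zero_derivs TV_fsupp by blast

lemma subsp_NI: "subsp NI"
  using subsp_TV unfolding subsp_def NI_def
  by (auto simp: lin_zero[OF lin_derivs] lin_lincomb[OF lin_derivs] TV_fsupp)

lemma tmul_TV: "f \<in> TV \<Longrightarrow> g \<in> TV \<Longrightarrow> tmul f g \<in> TV"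
proof -
  assume f: "f \<in> TV" and g: "g \<in> TV"
  then have "supp (tmul f g) \<subseteq> lists X"
    using supp_tmul[of f g] unfolding TV_def by fastforce
  then show ?thesis using f g by (simp add: TV_def)
qed

lemma gact_TV: "y \<in> X \<Longrightarrow> f \<in> TV \<Longrightarrow> gact y f \<in> TV"
  by (rule TV_lin[OF lin_gact _ subsp_TV])
     (auto simp: gact_wd act_closed intro!: subsp_smult[OF subsp_TV])

lemma deriv_word_TV: "u \<in> lists X \<Longrightarrow> deriv_word y u \<in> TV"
proof (induction u)
  case Nil
  then show ?case using subsp_zero[OF subsp_TV] by simp
next
  case (Cons x u)
  then show ?case
    by (cases "x = y") (auto simp: act_closed subsp_zero[OF subsp_TV]
        intro!: tmul_TV subsp_smult[OF subsp_TV] subsp_add[OF subsp_TV])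
qed

lemma deriv_TV: "f \<in> TV \<Longrightarrow> deriv y f \<in> TV"
  by (rule TV_lin[OF lin_deriv _ subsp_TV]) (simp_all add: deriv_word_TV)

lemma deriv_outside: "y \<notin> X \<Longrightarrow> f \<in> TV \<Longrightarrow> deriv y f = (\<lambda>_. 0)"
proof (rule TV_ext[OF lin_deriv lin_null])
  fix u assume "y \<notin> X" "u \<in> lists X"
  then show "deriv y (wd u) = (\<lambda>_. 0)"
  proof (induction u)
    case (Cons x u)
    then show ?case using lin_zero[OF lin_tmul_right[OF fsupp_wd[of "[x]"]]] by auto
  qed simp
qed

lemma deriv_NI: "f \<in> NI \<Longrightarrow> deriv y f \<in> NI"
  unfolding NI_def using deriv_TV by (auto dest: spec[of _ "y # _"])

text \<open>The cocycle identity multiplied over the letters of \<open>u\<close>. Together with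
  \<open>map_act_act\<close> it says that the operators \<open>gact\<close> satisfy the defining
  relation of the enveloping group.\<close>

lemma qc_act:
  assumes "y \<in> X" "z \<in> X" "u \<in> lists X"
  shows "qc (act y z) (map (act y) u) * qc y u = qc y (map (act z) u) * qc z u"
  using assms(3)
proof (induction u)
  case (Cons x u)
  then have "q (act y z) (act y x) * q y x = q y (act z x) * q z x"
    using cocycle assms by simp
  then show ?case using Cons by (simp add: algebra_simps)
qed simp

lemma map_act_act:
  "y \<in> X \<Longrightarrow> z \<in> X \<Longrightarrow> u \<in> lists X \<Longrightarrow>
    map (act (act y z) \<circ> act y) u = map (act y \<circ> act z) u"
  by (auto simp: act_dist)

text \<open>Conjugation by g_y turns the derivation for \<open>z\<close> into a multiple of the one
  for \<open>act y z\<close>. Injectivity of the translation by \<open>y\<close> ensures that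
  occurrences of \<open>act y z\<close> in the translated word come exactly from those of
  \<open>z\<close>.\<close>

lemma deriv_gact:
  assumes "y \<in> X" "z \<in> X" "f \<in> TV"
  shows "deriv (act y z) (gact y f) = (\<lambda>w. q y z * gact y (deriv z f) w)"
proof (rule TV_ext[OF lin_comp[OF lin_deriv lin_gact] lin_scale[OF lin_comp[OF lin_gact lin_deriv]] _ assms(3)])
  fix u assume "u \<in> lists X"
  then have "deriv (act y z) (gact y (wd u)) = (\<lambda>w. q y z * gact y (deriv_word z u) w)"
  proof (induction u)
    case Nil
    then show ?case
      by (simp add: gact_wd lin_smult[OF lin_deriv] lin_zero[OF lin_gact])
  next
    case (Cons x u)
    have x: "x \<in> X" and u: "u \<in> lists X" using Cons.hyps by auto
    have *: "qc y u * deriv_word (act y z) (map (act y) u) w = q y z * gact y (deriv_word z u) w" for w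
      using Cons.IH by (simp add: gact_wd lin_smult[OF lin_deriv] fun_eq_iff)
    have eq: "act y x = act y z \<longleftrightarrow> x = z" using act_inj assms x by blast
    have [simp]: "lin (tmul (wd v :: _ \<Rightarrow> 'k))" for v by (rule lin_tmul_right) simp
    have t: "qc y u * tmul (wd [v]) (deriv_word (act y z) (map (act y) u)) w =
        q y z * tmul (wd [v]) (gact y (deriv_word z u)) w" for v w
    proof -
      have "tmul (wd [v]) (\<lambda>w. qc y u * deriv_word (act y z) (map (act y) u) w) =
          tmul (wd [v]) (\<lambda>w. q y z * gact y (deriv_word z u) w)" using * by simp
      then show ?thesis
        by (simp add: lin_smult lin_fsupp[OF lin_gact] fun_eq_iff)
    qed
    have g: "gact y (deriv_word z (x # u)) = (\<lambda>w. q y x * tmul (wd [act y x]) (gact y (deriv_word z u)) w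
        + (if x = z then qc z u else 0) * (qc y (map (act z) u) * wd (map (act y \<circ> act z) u) w))"
      unfolding deriv_word.simps
      by (subst lin_lincomb[OF lin_gact]) (simp_all add: gact_tmul_letter gact_wd)
    show ?case
    proof
      fix w
      have "deriv (act y z) (gact y (wd (x # u))) w = q y x * (qc y u *
          tmul (wd [act y x]) (deriv_word (act y z) (map (act y) u)) w) + (if x = z then
          q y x * (qc (act y z) (map (act y) u) * qc y u) * wd (map (act (act y z) \<circ> act y) u) w else 0)"
        by (simp add: gact_wd lin_smult[OF lin_deriv] eq algebra_simps)
      also have "\<dots> = q y z * gact y (deriv_word z (x # u)) w"
        unfolding t g qc_act[OF assms(1,2) u] map_act_act[OF assms(1,2) u]
        by (simp add: algebra_simps)
      finally show "deriv (act y z) (gact y (wd (x # u))) w = q y z * gact y (deriv_word z (x # u)) w" .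
    qed
  qed
  then show "deriv (act y z) (gact y (wd u)) = (\<lambda>w. q y z * gact y (deriv z (wd u)) w)" by simp
qed

lemma gact_NI:
  assumes "y \<in> X" "f \<in> NI" shows "gact y f \<in> NI"
proof -
  have "derivs w (gact y f) [] = 0" for w
    using assms(2)
  proof (induction w arbitrary: f)
    case Nil
    then show ?case by (auto simp: gact_Nil NI_def TV_fsupp dest: spec[of _ "[]"])
  next
    case (Cons x w)
    show ?case
    proof (cases "x \<in> X")
      case True
      \<comment> \<open>Surjectivity of the translation lets every derivation by a letter of
        \<open>X\<close> be moved through \<open>gact y\<close>.\<close>
      then obtain z where z: "z \<in> X" "x = act y z" using act_surj assms(1) by metis
      have fs: "fsupp (gact y (deriv z f))"
        using Cons.prems NI_TV TV_fsupp lin_fsupp[OF lin_gact] lin_fsupp[OF lin_deriv] by blast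
      have "derivs (x # w) (gact y f) = derivs w (\<lambda>w. q y z * gact y (deriv z f) w)"
        using deriv_gact[OF assms(1) z(1)] Cons.prems NI_TV z(2) by simp
      then show ?thesis
        using Cons.IH[OF deriv_NI[OF Cons.prems]] by (simp add: lin_smult[OF lin_derivs] fs)
    next
      case False
      then show ?thesis
        using deriv_outside gact_TV assms(1) Cons.prems NI_TV lin_zero[OF lin_derivs] by simp
    qed
  qed
  then show ?thesis using gact_TV[OF assms(1) NI_TV[OF assms(2)]] by (simp add: NI_def)
qed

text \<open>Both cases are proved together: each of the two Leibniz summands again has a factor in
  \<open>NI\<close>, as \<open>NI\<close> is stable under derivations and under the group action. At
  the end, evaluation at \<open>[]\<close> is multiplicative.\<close>

lemma tmul_NI:
  assumes "f \<in> NI \<and> g \<in> TV \<or> f \<in> TV \<and> g \<in> NI"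
  shows "tmul f g \<in> NI"
proof -
  have "derivs w (tmul f g) [] = 0" for w
    using assms
  proof (induction w arbitrary: f g)
    case Nil
    then have "f [] = 0 \<or> g [] = 0" by (auto simp: NI_def dest: spec[of _ "[]"])
    then show ?case by auto
  next
    case (Cons y w)
    have TV: "f \<in> TV" "g \<in> TV" using Cons.prems NI_TV by auto
    show ?case
    proof (cases "y \<in> X")
      case True
      have "derivs w (tmul f (deriv y g)) [] = 0"
        by (rule Cons.IH) (use Cons.prems deriv_NI deriv_TV TV in blast)
      moreover have "derivs w (tmul (deriv y f) (gact y g)) [] = 0"
        by (rule Cons.IH) (use Cons.prems deriv_NI deriv_TV gact_TV gact_NI True TV in blast)
      ultimately show ?thesis
        using TV TV_fsupp tmul_TV deriv_TV gact_TV True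
        by (simp add: deriv_tmul lin_add[OF lin_derivs])
    next
      case False
      then show ?thesis using deriv_outside[OF False tmul_TV[OF TV]] lin_zero[OF lin_derivs] by simp
    qed
  qed
  moreover have "tmul f g \<in> TV" using assms NI_TV tmul_TV by blast
  ultimately show ?thesis by (simp add: NI_def)
qed

section \<open>The ideal is graded by length and by the enveloping group\<close>

definition braid_inv :: "('x list \<Rightarrow> bool) \<Rightarrow> bool" where
  "braid_inv P \<longleftrightarrow> (\<forall>p s. \<forall>x\<in>X. \<forall>y\<in>X. P (p @ [x, y] @ s) = P (p @ [act x y, x] @ s))"

lemma braid_inv_move:
  assumes "braid_inv P" "x \<in> X" "s \<in> lists X"
  shows "P (p @ map (act x) s @ x # t) = P (p @ x # s @ t)"
  using assms(3)
proof (induction s arbitrary: p)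
  case (Cons y s)
  then have "P ((p @ [act x y]) @ map (act x) s @ x # t) = P (p @ [act x y, x] @ s @ t)"
    using Cons.IH[of "p @ [act x y]"] by simp
  also have "\<dots> = P (p @ [x, y] @ s @ t)"
    using assms(1,2) Cons.hyps unfolding braid_inv_def by simp
  finally show ?case by simp
qed simp

text \<open>If \<open>v\<close> occurs in the derivative of \<open>u\<close>, then
  \<open>v @ [y]\<close> arises from \<open>u\<close> by braid moves, so \<open>P\<close> takes the
  same value on both. The new predicate is again braid invariant, which is why
  \<open>restrict_NI\<close> generalizes over \<open>P\<close>.\<close>

lemma deriv_restrict:
  assumes "braid_inv P" "f \<in> TV"
  shows "deriv y (\<lambda>w. if P w then f w else 0) = (\<lambda>w. if P (w @ [y]) then deriv y f w else 0)"
proof (rule TV_ext[OF lin_comp[OF lin_deriv lin_restrict] lin_comp[OF lin_restrict lin_deriv] _ assms(2)])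
  fix u assume u: "u \<in> lists X"
  have "P (v @ [y]) = P u" if v: "deriv_word y u v \<noteq> 0" for v
  proof -
    have "(\<Sum>i<length u. if u!i = y
       then qc y (drop (Suc i) u) * wd (take i u @ map (act y) (drop (Suc i) u)) v else 0) \<noteq> 0"
      using v by (simp add: deriv_word_sum)
    then obtain i where i: "i < length u" "u!i = y" "v = take i u @ map (act y) (drop (Suc i) u)"
      by (fastforce elim: sum.not_neutral_contains_not_neutral simp: wd_def split: if_splits)
    have "drop (Suc i) u \<in> lists X" using u by (auto dest: in_set_dropD)
    then have "P (v @ [y]) = P (take i u @ y # drop (Suc i) u)"
      using braid_inv_move[OF assms(1), of y "drop (Suc i) u" "take i u" "[]"] i u nth_mem[of i u] by auto
    then show ?thesis using i id_take_nth_drop[of i u] by simp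
  qed
  moreover have "(\<lambda>w. if P w then wd u w else 0) = (\<lambda>w. (if P u then 1 else 0) * (wd u w :: 'k))"
    by (auto simp: wd_def)
  ultimately show "deriv y (\<lambda>w. if P w then wd u w else 0) =
      (\<lambda>w. if P (w @ [y]) then deriv y (wd u) w else 0)"
    by (auto simp: lin_smult[OF lin_deriv] fun_eq_iff)
qed

lemma restrict_TV: "f \<in> TV \<Longrightarrow> (\<lambda>w. if P w then f w else 0) \<in> TV"
  unfolding TV_def supp_def by (auto elim: rev_finite_subset split: if_splits)

lemma restrict_NI:
  assumes "braid_inv P" "f \<in> NI"
  shows "(\<lambda>w. if P w then f w else 0) \<in> NI"
proof -
  have "derivs w (\<lambda>w. if P w then f w else 0) [] = 0" for w
    using assms
  proof (induction w arbitrary: P f)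
    case Nil
    then show ?case by (auto simp: NI_def dest: spec[of _ "[]"])
  next
    case (Cons y w)
    have "braid_inv (\<lambda>w. P (w @ [y]))" using Cons.prems(1) unfolding braid_inv_def by simp
    from Cons.IH[OF this deriv_NI[OF Cons.prems(2), of y]] show ?case
      using deriv_restrict[OF Cons.prems(1) NI_TV[OF Cons.prems(2)], of y] by simp
  qed
  then show ?thesis using restrict_TV[OF NI_TV[OF assms(2)]] by (simp add: NI_def)
qed

end

section \<open>The coproduct\<close>

definition tens :: "('a \<Rightarrow> 'k::comm_ring_1) \<Rightarrow> ('b \<Rightarrow> 'k) \<Rightarrow> 'a \<times> 'b \<Rightarrow> 'k" where
  "tens P R = (\<lambda>(l, r). P l * R r)"

lemma supp_tens: "supp (tens P R) \<subseteq> supp P \<times> supp R"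
  by (auto simp: supp_def tens_def)

lemma fsupp_tens [simp]: "fsupp P \<Longrightarrow> fsupp R \<Longrightarrow> fsupp (tens P R)"
  by (rule finite_subset[OF supp_tens]) simp

lemma lin_tens_right [intro]: "fsupp P \<Longrightarrow> lin (tens P)"
  unfolding lin_def by (simp, auto simp: tens_def algebra_simps)

lemma lin_tens_left [intro]: "fsupp R \<Longrightarrow> lin (\<lambda>P. tens P R)"
  unfolding lin_def by (simp, auto simp: tens_def algebra_simps)

lemma tens_wd: "tens (wd p) (wd r) = (wd (p, r) :: _ \<Rightarrow> 'k::comm_ring_1)"
  by (auto simp: tens_def wd_def)

lemma lin_ext_tens:
  assumes "lin F" "lin G" "\<And>p r. p \<in> A \<Longrightarrow> r \<in> B \<Longrightarrow> F (tens (wd p) (wd r)) = G (tens (wd p) (wd r))"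
    "fsupp t" "supp t \<subseteq> A \<times> B"
  shows "F t = G t"
  by (rule lin_ext[OF assms(1,2) _ assms(4,5)]) (use assms(3) in \<open>auto simp: tens_wd\<close>)

lemma lin_ext_tens_UNIV:
  assumes "lin F" "lin G" "\<And>p r. F (tens (wd p) (wd r)) = G (tens (wd p) (wd r))" "fsupp t"
  shows "F t = G t"
  by (rule lin_ext_tens[OF assms(1,2), of UNIV UNIV]) (use assms in auto)

lemma lin_bilin:
  assumes P: "fsupp P" and R: "fsupp R"
    and FL: "\<And>R. fsupp R \<Longrightarrow> lin (\<lambda>P. F P R)" and FR: "\<And>P. fsupp P \<Longrightarrow> lin (F P)"
    and GL: "\<And>R. fsupp R \<Longrightarrow> lin (\<lambda>P. G P R)" and GR: "\<And>P. fsupp P \<Longrightarrow> lin (G P)"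
    and eq: "\<And>p r. F (wd p) (wd r) = G (wd p) (wd r)"
  shows "F P R = G P R"
proof -
  have "F (wd p) R = G (wd p) R" for p
    by (rule lin_ext_UNIV[OF FR GR _ R]) (auto simp: eq)
  then show ?thesis by (intro lin_ext_UNIV[OF FL GL _ P]) (auto simp: R)
qed

lemma inj_slice: "inj (\<lambda>l. (l, r))"
  by (simp add: inj_on_def)

lemma fsupp_slice: "fsupp t \<Longrightarrow> fsupp (\<lambda>l. t (l, r))"
proof -
  assume "fsupp t"
  moreover have "supp (\<lambda>l. t (l, r)) = (\<lambda>l. (l, r)) -` supp t" by (auto simp: supp_def)
  ultimately show ?thesis using finite_vimageI[OF _ inj_slice] by simp
qed

lemma lin_slice [intro]: "lin (\<lambda>t l. t (l, r) :: 'k::comm_ring_1)"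
  by (simp add: lin_def fsupp_slice)

context braiding
begin

text \<open>Left multiplication by the coproduct v_x \<otimes> 1 + 1 \<otimes> v_x of a letter. In
  the second summand v_x is braided past the left factor.\<close>

definition cop_left :: "'x \<Rightarrow> ('x list \<times> 'x list \<Rightarrow> 'k) \<Rightarrow> 'x list \<times> 'x list \<Rightarrow> 'k" where
  "cop_left x = lext (\<lambda>(p, r) t. tens (wd (x # p)) (wd r) t + tens (gact x (wd p)) (wd (x # r)) t)"

definition gact2 :: "'x \<Rightarrow> ('x list \<times> 'x list \<Rightarrow> 'k) \<Rightarrow> 'x list \<times> 'x list \<Rightarrow> 'k" where
  "gact2 y = lext (\<lambda>(p, r). tens (gact y (wd p)) (gact y (wd r)))"

definition deriv2 :: "'x \<Rightarrow> ('x list \<times> 'x list \<Rightarrow> 'k) \<Rightarrow> 'x list \<times> 'x list \<Rightarrow> 'k" where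
  "deriv2 y = lext (\<lambda>(p, r). tens (wd p) (deriv y (wd r)))"

lemma fsupp_gact [simp]: "fsupp f \<Longrightarrow> fsupp (gact y f)"
  by (rule lin_fsupp[OF lin_gact])

lemma fsupp_deriv [simp]: "fsupp f \<Longrightarrow> fsupp (deriv y f)"
  by (rule lin_fsupp[OF lin_deriv])

lemma lin_cop_left [intro]: "lin (cop_left x)"
  unfolding cop_left_def by (rule lin_lext) (simp add: case_prod_beta)

lemma lin_gact2 [intro]: "lin (gact2 x)"
  unfolding gact2_def by (rule lin_lext) (simp add: case_prod_beta)

lemma lin_deriv2 [intro]: "lin (deriv2 x)"
  unfolding deriv2_def by (rule lin_lext) (simp add: case_prod_beta)

lemma cop_left_tens:
  assumes "fsupp P" "fsupp R"
  shows "cop_left x (tens P R) = (\<lambda>t. tens (tmul (wd [x]) P) R t + tens (gact x P) (tmul (wd [x]) R) t)"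
  by (rule lin_bilin[OF assms, of "\<lambda>P R. cop_left x (tens P R)"])
     (auto intro!: lin_plus lin_comp[OF lin_cop_left lin_tens_left] lin_comp[OF lin_cop_left lin_tens_right]
       lin_comp[OF lin_tens_left lin_tmul_right] lin_comp[OF lin_tens_left lin_gact]
       lin_comp[OF lin_tens_right lin_tmul_right] lin_tens_right
       simp: tmul_wd, simp add: cop_left_def tens_wd)

lemma gact2_tens:
  assumes "fsupp P" "fsupp R"
  shows "gact2 y (tens P R) = tens (gact y P) (gact y R)"
  by (rule lin_bilin[OF assms, of "\<lambda>P R. gact2 y (tens P R)"])
     (auto intro!: lin_comp[OF lin_gact2 lin_tens_left] lin_comp[OF lin_gact2 lin_tens_right]
       lin_comp[OF lin_tens_left lin_gact] lin_comp[OF lin_tens_right lin_gact], simp add: gact2_def tens_wd)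

lemma deriv2_tens:
  assumes "fsupp P" "fsupp R"
  shows "deriv2 y (tens P R) = tens P (deriv y R)"
  by (rule lin_bilin[OF assms, of "\<lambda>P R. deriv2 y (tens P R)"])
     (auto intro!: lin_comp[OF lin_deriv2 lin_tens_left] lin_comp[OF lin_deriv2 lin_tens_right]
       lin_tens_left lin_comp[OF lin_tens_right lin_deriv], simp add: deriv2_def tens_wd)

lemma gact_tmul:
  assumes "fsupp f" "fsupp g"
  shows "gact y (tmul f g) = tmul (gact y f) (gact y g)"
proof (rule lin_bilin[OF assms, of "\<lambda>f g. gact y (tmul f g)"])
  fix u v
  show "gact y (tmul (wd u) (wd v)) = tmul (gact y (wd u)) (gact y (wd v))"
    unfolding tmul_wd gact_wd
    by (simp add: lin_smult[OF lin_tmul_right] lin_smult[OF lin_tmul_left] tmul_wd mult_ac)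
qed (auto intro!: lin_comp[OF lin_gact lin_tmul_left] lin_comp[OF lin_gact lin_tmul_right]
       lin_comp[OF lin_tmul_left lin_gact] lin_comp[OF lin_tmul_right lin_gact])

lemma deriv_tmul_letter:
  assumes "fsupp f"
  shows "deriv y (tmul (wd [x]) f) = (\<lambda>w. tmul (wd [x]) (deriv y f) w + (if x = y then 1 else 0) * gact y f w)"
proof -
  have "deriv_word y [x] = (\<lambda>w. (if x = y then 1 else 0) * wd [] w)"
    by (simp add: lin_zero[OF lin_tmul_right])
  then have "tmul (deriv y (wd [x])) (gact y f) = (\<lambda>w. (if x = y then 1 else 0) * gact y f w)"
    using assms by (simp only: deriv_wd lin_smult[OF lin_tmul_left] fsupp_gact fsupp_wd tmul_wd_Nil)
  then show ?thesis using assms by (simp only: deriv_tmul fsupp_wd)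
qed

lemma cop_word_Cons: "cop_word act q (x # w) = cop_left x (cop_word act q w)"
proof -
  have qc: "(\<Prod>i<length p. q x (p ! i)) = qc x p" for p
    by (simp add: qc_def prod.list_conv_set_nth atLeast0LessThan)
  have "(\<lambda>(p, r) t. (if t = (x # p, r) then 1 else 0)
          + (if t = (map (act x) p, x # r) then \<Prod>i<length p. q x (p ! i) else 0)) =
        (\<lambda>(p, r) t. tens (wd (x # p)) (wd r) t + tens (gact x (wd p)) (wd (x # r)) t)"
    unfolding qc gact_wd by (auto simp: fun_eq_iff tens_def wd_def)
  then show ?thesis by (simp add: cop_left_def)
qed

lemma fsupp_cop_word [simp]: "fsupp (cop_word act q w)"
proof (induction w)
  case (Cons x w)
  then show ?case using lin_fsupp[OF lin_cop_left] cop_word_Cons by metis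
qed simp

lemma lin_cop [intro]: "lin (cop act q)"
  unfolding cop_def by (rule lin_lext) simp

lemma cop_wd [simp]: "cop act q (wd u) = cop_word act q u"
  by (simp add: cop_def)

lemma cop_tmul_letter: "fsupp f \<Longrightarrow> cop act q (tmul (wd [x]) f) = cop_left x (cop act q f)"
  by (rule lin_ext_UNIV[OF lin_comp[OF lin_cop lin_tmul_right] lin_comp[OF lin_cop_left lin_cop]])
     (simp_all add: tmul_wd cop_word_Cons del: cop_word.simps)

text \<open>The extra term arises when the derivation hits the new letter in 1 \<otimes> v_x. The
  left factor already carries the action of g_x and the right factor receives that of g_y; for
  \<open>x = y\<close> they form the diagonal action.\<close>

lemma deriv2_cop_left:
  assumes "fsupp t"
  shows "deriv2 y (cop_left x t) =
    (\<lambda>z. cop_left x (deriv2 y t) z + (if x = y then 1 else 0) * gact2 y t z)"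
proof (rule lin_ext_tens_UNIV[OF lin_comp[OF lin_deriv2 lin_cop_left]
      lin_plus[OF lin_comp[OF lin_cop_left lin_deriv2] lin_scale[OF lin_gact2]] _ assms])
  fix p r
  show "deriv2 y (cop_left x (tens (wd p) (wd r))) = (\<lambda>z. cop_left x (deriv2 y (tens (wd p) (wd r))) z
      + (if x = y then 1 else 0) * gact2 y (tens (wd p) (wd r)) z)"
    by (simp add: cop_left_tens deriv2_tens gact2_tens lin_add[OF lin_deriv2] deriv_tmul_letter
        lin_lincomb[OF lin_tens_right] lin_add[OF lin_tens_right] del: deriv_wd) (auto simp: add.assoc)
qed

lemma counit_cop:
  assumes "fsupp f" shows "(\<lambda>l. cop act q f (l, [])) = f"
proof (rule lin_ext_UNIV[OF lin_comp[OF lin_slice lin_cop] lin_id _ assms])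
  fix u
  show "(\<lambda>l. cop act q (wd u) (l, [])) = wd u"
  proof (induction u)
    case Nil
    then show ?case by (simp only: cop_wd cop_word.simps) (auto simp: wd_def)
  next
    case (Cons x u)
    have "(\<lambda>l. cop_left x t (l, [])) = tmul (wd [x]) (\<lambda>l. t (l, []))" if "fsupp t" for t
    proof (rule lin_ext_tens_UNIV[OF lin_comp[OF lin_slice lin_cop_left] lin_comp[OF lin_tmul_right lin_slice] _ that])
      fix p r :: "'x list"
      have "(\<lambda>l. tens (wd p) (wd r) (l, [])) = (\<lambda>l. wd r [] * (wd p l :: 'k))"
        by (auto simp: tens_def)
      then show "(\<lambda>l. cop_left x (tens (wd p) (wd r)) (l, [])) =
          tmul (wd [x]) (\<lambda>l. tens (wd p) (wd r) (l, []))"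
        by (simp add: cop_left_tens lin_smult[OF lin_tmul_right]) (simp add: tens_def mult.commute wd_def[of "[x]"])
    qed simp
    then show ?case using Cons by (simp add: cop_word_Cons tmul_wd del: cop_word.simps)
  qed
qed

primrec gacts :: "'x list \<Rightarrow> ('x list \<Rightarrow> 'k) \<Rightarrow> 'x list \<Rightarrow> 'k" where
  "gacts [] f = f"
| "gacts (x # r) f = gact x (gacts r f)"

text \<open>Multiplication of \<open>T(V) \<otimes> T(V)\<close> as an algebra in the braided category.\<close>

definition mul2 :: "('x list \<times> 'x list \<Rightarrow> 'k) \<Rightarrow> ('x list \<times> 'x list \<Rightarrow> 'k) \<Rightarrow> 'x list \<times> 'x list \<Rightarrow> 'k" where
  "mul2 s t = lext (\<lambda>(p, r). lext (\<lambda>(p', r'). tens (tmul (wd p) (gacts r (wd p'))) (wd (r @ r'))) t) s"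

lemma lin_gacts [intro]: "lin (gacts r)"
proof (induction r)
  case (Cons x r)
  then show ?case using lin_comp[OF lin_gact Cons] by simp
qed (simp add: lin_id)

lemma fsupp_gacts [simp]: "fsupp f \<Longrightarrow> fsupp (gacts r f)"
  by (rule lin_fsupp[OF lin_gacts])

lemma gacts_append: "gacts (r @ s) f = gacts r (gacts s f)"
  by (induction r) auto

lemma lin_mul2_inner: "lin (lext (\<lambda>(p', r'). tens (tmul (wd p) (gacts r (wd p'))) (wd (r @ r'))))"
  by (rule lin_lext) (simp add: case_prod_beta)

lemma lin_mul2_left: "fsupp t \<Longrightarrow> lin (\<lambda>s. mul2 s t)"
  unfolding mul2_def
  by (rule lin_lext) (simp only: case_prod_beta lin_fsupp[OF lin_mul2_inner])

lemma lin_mul2_right: "fsupp s \<Longrightarrow> lin (mul2 s)"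
  unfolding mul2_def lext_def[of _ s] case_prod_beta
  by (intro lin_sums lin_scale) (simp_all only: lin_mul2_inner[unfolded case_prod_beta])

text \<open>The right factor of the first tensor has to be a word, since its letters act on
  \<open>P'\<close> and different words may act differently.\<close>

lemma mul2_tens:
  assumes "fsupp P" "fsupp P'" "fsupp R'"
  shows "mul2 (tens P (wd r)) (tens P' R') = tens (tmul P (gacts r P')) (tmul (wd r) R')"
proof -
  have 1: "mul2 (tens (wd p) (wd r)) (tens P' R') = tens (tmul (wd p) (gacts r P')) (tmul (wd r) R')" for p
  proof (rule lin_bilin[OF assms(2,3), of "\<lambda>P' R'. mul2 (tens (wd p) (wd r)) (tens P' R')"])
    fix p' r'
    show "mul2 (tens (wd p) (wd r)) (tens (wd p') (wd r')) = tens (tmul (wd p) (gacts r (wd p'))) (tmul (wd r) (wd r'))"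
      by (simp add: tens_wd mul2_def tmul_wd)
  qed (auto intro!: lin_comp[OF lin_mul2_right lin_tens_left] lin_comp[OF lin_mul2_right lin_tens_right]
       lin_comp[OF lin_tens_left lin_comp[OF lin_tmul_right lin_gacts]] lin_comp[OF lin_tens_right lin_tmul_right])
  show ?thesis
    by (rule lin_ext_UNIV[OF lin_comp[OF lin_mul2_left lin_tens_left] lin_comp[OF lin_tens_left lin_tmul_left]])
      (use 1 assms in auto)
qed

lemma mul2_Nil: "fsupp t \<Longrightarrow> mul2 (wd ([], [])) t = t"
  by (rule lin_ext_tens_UNIV[OF lin_mul2_right lin_id])
     (simp_all add: mul2_tens flip: tens_wd)

lemma cop_left_mul2:
  assumes "fsupp s" "fsupp t"
  shows "cop_left x (mul2 s t) = mul2 (cop_left x s) t"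
proof -
  have "cop_left x (mul2 (tens (wd p) (wd r)) t) = mul2 (cop_left x (tens (wd p) (wd r))) t" for p r
  proof (rule lin_ext_tens_UNIV[OF lin_comp[OF lin_cop_left lin_mul2_right] lin_mul2_right _ assms(2)])
    fix p' r'
    have "mul2 (\<lambda>t. tens (tmul (wd [x]) (wd p)) (wd r) t + tens (gact x (wd p)) (wd (x # r)) t) (tens (wd p') (wd r')) =
        (\<lambda>z. mul2 (tens (tmul (wd [x]) (wd p)) (wd r)) (tens (wd p') (wd r')) z
          + mul2 (tens (gact x (wd p)) (wd (x # r))) (tens (wd p') (wd r')) z)"
      by (rule lin_add[OF lin_mul2_left]) simp_all
    then show "cop_left x (mul2 (tens (wd p) (wd r)) (tens (wd p') (wd r'))) =
        mul2 (cop_left x (tens (wd p) (wd r))) (tens (wd p') (wd r'))"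
      by (simp add: cop_left_tens mul2_tens gact_tmul tmul_letter_assoc tmul_wd_Cons[of x r]
          tmul_wd[of "[x]" r])
  qed (auto intro: lin_fsupp[OF lin_cop_left])
  then show ?thesis
    by (intro lin_ext_tens_UNIV[OF lin_comp[OF lin_cop_left lin_mul2_left]
          lin_comp[OF lin_mul2_left lin_cop_left] _ assms(1)]) (use assms in auto)
qed

text \<open>Induction on the letters of the left factor. The only associativity required is that
  \<open>cop_left x\<close> commutes with multiplication from the right, which is
  \<open>cop_left_mul2\<close>.\<close>

lemma cop_tmul:
  assumes "fsupp f" "fsupp g"
  shows "cop act q (tmul f g) = mul2 (cop act q f) (cop act q g)"
proof -
  have fg: "fsupp (cop act q g)" by (rule lin_fsupp[OF lin_cop assms(2)])
  have "cop act q (tmul (wd u) g) = mul2 (cop_word act q u) (cop act q g)" for u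
  proof (induction u)
    case (Cons x u)
    have "tmul (wd (x # u)) g = tmul (wd [x]) (tmul (wd u) g)" by (rule tmul_wd_Cons)
    then show ?case
      using Cons assms fg by (simp add: cop_tmul_letter cop_left_mul2 cop_word_Cons del: cop_word.simps)
  qed (simp add: mul2_Nil fg)
  then show ?thesis
    by (intro lin_ext_UNIV[OF lin_comp[OF lin_cop lin_tmul_left] lin_comp[OF lin_mul2_left lin_cop] _ assms(1)])
       (use assms fg in auto)
qed

end

section \<open>The coideal property of the ideal\<close>

context rack_cocycle
begin

text \<open>For \<open>M = NI\<close> this is the kernel of the projection onto \<open>B(V) \<otimes> B(V)\<close>; in general it is the
  preimage of \<open>B(V) \<otimes> M\<close>.\<close>

inductive_set tsum :: "('x list \<Rightarrow> 'k) set \<Rightarrow> ('x list \<times> 'x list \<Rightarrow> 'k) set" for M where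
  zero: "(\<lambda>_. 0) \<in> tsum M"
| add: "s \<in> tsum M \<Longrightarrow> t \<in> tsum M \<Longrightarrow> (\<lambda>z. s z + t z) \<in> tsum M"
| right: "P \<in> TV \<Longrightarrow> R \<in> M \<Longrightarrow> tens P R \<in> tsum M"
| left: "P \<in> NI \<Longrightarrow> R \<in> TV \<Longrightarrow> tens P R \<in> tsum M"

lemma tsum_smult: "t \<in> tsum M \<Longrightarrow> (\<lambda>z. k * t z) \<in> tsum M"
proof (induction rule: tsum.induct)
  case zero
  then show ?case using tsum.zero by simp
next
  case (add s t)
  then show ?case using tsum.add by (fastforce simp: distrib_left)
next
  case (right P R)
  have "(\<lambda>z. k * tens P R z) = tens (\<lambda>l. k * P l) R" by (auto simp: tens_def mult.assoc)
  then show ?case using tsum.right subsp_smult[OF subsp_TV] right by metis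
next
  case (left P R)
  have "(\<lambda>z. k * tens P R z) = tens (\<lambda>l. k * P l) R" by (auto simp: tens_def mult.assoc)
  then show ?case using tsum.left subsp_smult[OF subsp_NI] left by metis
qed

lemma subsp_tsum: "subsp (tsum M)"
  unfolding subsp_def using tsum.zero tsum.add tsum_smult by blast

lemma tsum_mono: "t \<in> tsum M \<Longrightarrow> M \<subseteq> M' \<Longrightarrow> t \<in> tsum M'"
  by (induction rule: tsum.induct) (auto intro: tsum.intros)

lemma tsum_fsupp:
  assumes "M \<subseteq> TV" "t \<in> tsum M" shows "fsupp t"
  using assms(2)
  by (induction rule: tsum.induct) (use assms(1) NI_TV TV_fsupp in auto)

text \<open>Gaussian elimination: if the pairing of the right tensor factors with all iterated derivations
  lands in the ideal, then the tensor vanishes in \<open>B(V) \<otimes> B(V)\<close>, because these functionals separate the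
  points of \<open>B(V)\<close>.\<close>

lemma tsum_eliminate:
  assumes "finite K" "\<And>k. k \<in> K \<Longrightarrow> P k \<in> TV" "\<And>k. k \<in> K \<Longrightarrow> R k \<in> TV"
    "\<And>w. (\<lambda>l. \<Sum>k\<in>K. P k l * derivs w (R k) []) \<in> NI"
  shows "(\<lambda>z. \<Sum>k\<in>K. tens (P k) (R k) z) \<in> tsum NI"
  using assms
proof (induction "card K" arbitrary: K R rule: less_induct)
  case less
  show ?case
  proof (cases "\<forall>k\<in>K. R k \<in> NI")
    case True
    then show ?thesis using less.prems by (intro subsp_sum[OF subsp_tsum] tsum.right) auto
  next
    case False
    then obtain k0 where k0: "k0 \<in> K" "R k0 \<notin> NI" by blast
    then obtain w0 where w0: "derivs w0 (R k0) [] \<noteq> 0" using less.prems(3) by (auto simp: NI_def)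
    \<comment> \<open>The normalization gives \<open>b k0 = 1\<close>, so \<open>R' k0\<close>
      vanishes and the index \<open>k0\<close> drops out. The left factor \<open>Q\<close> collected
      at \<open>R k0\<close> is a multiple of the pairing with \<open>w0\<close>, hence lies in the
      ideal.\<close>
    define b where "b k = derivs w0 (R k) [] / derivs w0 (R k0) []" for k
    define R' where "R' k = (\<lambda>w. R k w - b k * R k0 w)" for k
    define Q where "Q = (\<lambda>l. \<Sum>k\<in>K. P k l * b k)"
    have b0: "b k0 = 1" using w0 by (simp add: b_def)
    have R': "R' k \<in> TV" if "k \<in> K" for k
      unfolding R'_def using less.prems(3) that k0(1) by (intro subsp_diff[OF subsp_TV] subsp_smult[OF subsp_TV])
    have "Q = (\<lambda>l. (1 / derivs w0 (R k0) []) * (\<Sum>k\<in>K. P k l * derivs w0 (R k) []))"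
      unfolding Q_def b_def by (simp add: sum_divide_distrib)
    then have Q: "Q \<in> NI"
      using subsp_smult[OF subsp_NI less.prems(4)[of w0], of "1 / derivs w0 (R k0) []"] by simp
    have d: "derivs w (R' k) [] = derivs w (R k) [] - b k * derivs w (R k0) []" if "k \<in> K" for k w
      unfolding R'_def using less.prems(3)[OF that] less.prems(3)[OF k0(1)] TV_fsupp
      by (simp add: lin_diff[OF lin_derivs] lin_smult[OF lin_derivs])
    have "(\<lambda>z. \<Sum>k\<in>K - {k0}. tens (P k) (R' k) z) \<in> tsum NI"
    proof (rule less.hyps)
      show "card (K - {k0}) < card K" using k0 less.prems(1) by (meson card_Diff1_less)
      fix w
      have "(\<Sum>k\<in>K - {k0}. P k l * derivs w (R' k) []) =
          (\<Sum>k\<in>K. P k l * derivs w (R k) []) - derivs w (R k0) [] * Q l" for l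
      proof -
        have "(\<Sum>k\<in>K - {k0}. P k l * derivs w (R' k) []) = (\<Sum>k\<in>K. P k l * derivs w (R' k) [])"
          using less.prems(1) k0 d[OF k0(1)] b0 by (simp add: sum.remove[of K k0])
        also have "\<dots> = (\<Sum>k\<in>K. P k l * derivs w (R k) []) - derivs w (R k0) [] * Q l"
          by (simp add: d Q_def sum_distrib_left algebra_simps flip: sum_subtractf)
        finally show ?thesis .
      qed
      then show "(\<lambda>l. \<Sum>k\<in>K - {k0}. P k l * derivs w (R' k) []) \<in> NI"
        using subsp_diff[OF subsp_NI less.prems(4) subsp_smult[OF subsp_NI Q]] by simp
    qed (use less.prems R' in auto)
    then have "(\<lambda>z. tens Q (R k0) z + (\<Sum>k\<in>K - {k0}. tens (P k) (R' k) z)) \<in> tsum NI"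
      using tsum.left[OF Q less.prems(3)[OF k0(1)]] tsum.add by blast
    moreover have "tens Q (R k0) z + (\<Sum>k\<in>K - {k0}. tens (P k) (R' k) z) = (\<Sum>k\<in>K. tens (P k) (R k) z)" for z
    proof -
      have "(\<Sum>k\<in>K - {k0}. tens (P k) (R' k) z) = (\<Sum>k\<in>K. tens (P k) (R' k) z)"
        using less.prems(1) k0 b0 by (simp add: sum.remove[of K k0] R'_def tens_def case_prod_beta)
      also have "\<dots> = (\<Sum>k\<in>K. tens (P k) (R k) z) - tens Q (R k0) z"
        by (simp add: R'_def Q_def tens_def case_prod_beta sum_distrib_right sum_distrib_left
            algebra_simps flip: sum_subtractf)
      finally show ?thesis by simp
    qed
    ultimately show ?thesis by simp
  qed
qed

definition TT :: "('x list \<times> 'x list \<Rightarrow> 'k) set" where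
  "TT = {t. fsupp t \<and> supp t \<subseteq> lists X \<times> lists X}"

lemma TT_fsupp: "t \<in> TT \<Longrightarrow> fsupp t"
  by (simp add: TT_def)

lemma subsp_TT: "subsp TT"
proof -
  have "supp (\<lambda>w. f w + k * g w) \<subseteq> lists X \<times> lists X"
    if "supp f \<subseteq> lists X \<times> lists X" "supp g \<subseteq> lists X \<times> lists X"
    for f g :: "'x list \<times> 'x list \<Rightarrow> 'k" and k
    using supp_lincomb[of f k g] that by blast
  then show ?thesis by (simp add: TT_def subsp_def)
qed

lemma tens_TT: "P \<in> TV \<Longrightarrow> R \<in> TV \<Longrightarrow> tens P R \<in> TT"
  using supp_tens[of P R] unfolding TT_def TV_def by (auto simp del: in_lists_conv_set)

lemma TT_lin:
  assumes "lin F" "\<And>p r. p \<in> lists X \<Longrightarrow> r \<in> lists X \<Longrightarrow> F (tens (wd p) (wd r)) \<in> M" "subsp M" "t \<in> TT"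
  shows "F t \<in> M"
  by (rule lin_subsp[OF assms(1,3), of "lists X \<times> lists X"])
     (use assms in \<open>auto simp: TT_def tens_wd simp del: in_lists_conv_set\<close>)

lemma TT_ext:
  assumes "lin F" "lin G"
    "\<And>p r. p \<in> lists X \<Longrightarrow> r \<in> lists X \<Longrightarrow> F (tens (wd p) (wd r)) = G (tens (wd p) (wd r))" "t \<in> TT"
  shows "F t = G t"
  by (rule lin_ext_tens[OF assms(1,2), of "lists X" "lists X"]) (use assms in \<open>auto simp: TT_def\<close>)

lemma cop_left_TT: "x \<in> X \<Longrightarrow> t \<in> TT \<Longrightarrow> cop_left x t \<in> TT"
  by (rule TT_lin[OF lin_cop_left _ subsp_TT])
     (auto simp: cop_left_tens tmul_wd intro!: subsp_add[OF subsp_TT] tens_TT gact_TV)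

lemma cop_word_TT: "u \<in> lists X \<Longrightarrow> cop_word act q u \<in> TT"
proof (induction u)
  case Nil
  then show ?case using tens_TT[of "wd []" "wd []"] by (simp add: tens_wd)
next
  case (Cons x u)
  then show ?case using cop_left_TT by (simp add: cop_word_Cons del: cop_word.simps)
qed

lemma cop_TT: "f \<in> TV \<Longrightarrow> cop act q f \<in> TT"
  by (rule TV_lin[OF lin_cop _ subsp_TT]) (simp_all add: cop_word_TT)

lemma gact_gact:
  assumes "x \<in> X" "y \<in> X" "f \<in> TV"
  shows "gact (act y x) (gact y f) = gact y (gact x f)"
proof (rule TV_ext[OF lin_comp[OF lin_gact lin_gact] lin_comp[OF lin_gact lin_gact] _ assms(3)])
  fix u assume u: "u \<in> lists X"
  have "gact (act y x) (gact y (wd u)) =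
      (\<lambda>w. (qc (act y x) (map (act y) u) * qc y u) * wd (map (act (act y x) \<circ> act y) u) w)"
    by (simp add: gact_wd lin_smult[OF lin_gact]) (simp add: mult_ac)
  also have "\<dots> = gact y (gact x (wd u))"
    unfolding qc_act[OF assms(2,1) u] map_act_act[OF assms(2,1) u]
    by (simp add: gact_wd lin_smult[OF lin_gact]) (simp add: mult_ac)
  finally show "gact (act y x) (gact y (wd u)) = gact y (gact x (wd u))" .
qed

lemma gact2_cop_left:
  assumes "x \<in> X" "y \<in> X" "t \<in> TT"
  shows "gact2 y (cop_left x t) = (\<lambda>z. q y x * cop_left (act y x) (gact2 y t) z)"
proof (rule TT_ext[OF lin_comp[OF lin_gact2 lin_cop_left] lin_scale[OF lin_comp[OF lin_cop_left lin_gact2]] _ assms(3)])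
  fix p r assume "p \<in> lists X" "r \<in> lists X"
  then have "gact (act y x) (gact y (wd p)) = gact y (gact x (wd p))"
    using gact_gact[of x y "wd p"] assms by simp
  then show "gact2 y (cop_left x (tens (wd p) (wd r))) =
      (\<lambda>z. q y x * cop_left (act y x) (gact2 y (tens (wd p) (wd r))) z)"
    by (simp add: cop_left_tens gact2_tens lin_add[OF lin_gact2] gact_tmul_letter
        lin_smult[OF lin_tens_right] lin_smult[OF lin_tens_left] distrib_left)
qed

lemma cop_gact:
  assumes "y \<in> X" "f \<in> TV"
  shows "cop act q (gact y f) = gact2 y (cop act q f)"
proof (rule TV_ext[OF lin_comp[OF lin_cop lin_gact] lin_comp[OF lin_gact2 lin_cop] _ assms(2)])
  fix u assume "u \<in> lists X"
  then show "cop act q (gact y (wd u)) = gact2 y (cop act q (wd u))"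
  proof (induction u)
    case Nil
    have "gact2 y (tens (wd []) (wd [])) = tens (wd []) (wd [])"
      by (subst gact2_tens) (simp_all add: gact_wd)
    then show ?case by (simp add: gact_wd tens_wd)
  next
    case (Cons x u)
    have "gact y (wd (x # u)) = (\<lambda>w. q y x * tmul (wd [act y x]) (gact y (wd u)) w)"
      using gact_tmul_letter[of "wd u" y x] by (simp add: tmul_wd)
    then show ?case
      using Cons assms(1) gact2_cop_left[of x y "cop_word act q u"]
      by (simp add: lin_smult[OF lin_cop] cop_tmul_letter cop_word_Cons cop_word_TT
          del: cop_word.simps in_lists_conv_set)
  qed
qed

lemma deriv2_cop:
  assumes "f \<in> TV"
  shows "deriv2 y (cop act q f) = cop act q (deriv y f)"
proof (rule TV_ext[OF lin_comp[OF lin_deriv2 lin_cop] lin_comp[OF lin_cop lin_deriv] _ assms])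
  fix u assume "u \<in> lists X"
  then show "deriv2 y (cop act q (wd u)) = cop act q (deriv y (wd u))"
  proof (induction u)
    case Nil
    have "deriv2 y (tens (wd []) (wd [])) = (\<lambda>_. 0)"
      by (subst deriv2_tens) (simp_all add: lin_zero[OF lin_tens_right])
    then show ?case by (simp add: tens_wd lin_zero[OF lin_cop])
  next
    case (Cons x u)
    have "deriv y (wd (x # u)) =
        (\<lambda>w. tmul (wd [x]) (deriv y (wd u)) w + (if x = y then 1 else 0) * gact y (wd u) w)"
      using deriv_tmul_letter[of "wd u" y x] by (simp add: tmul_wd)
    then show ?case
      using Cons cop_gact[of x "wd u"]
      by (simp add: lin_lincomb[OF lin_cop] cop_tmul_letter cop_word_Cons deriv2_cop_left
          del: cop_word.simps in_lists_conv_set deriv_word.simps) auto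
  qed
qed

text \<open>Derivations on the right tensor factor commute with the coproduct by
  \<open>deriv2_cop\<close>. Evaluating the right factor at \<open>[]\<close> is the counit, so
  pairing it with the functional of \<open>w\<close> returns the iterated derivative itself.\<close>

lemma slice_derivs:
  assumes "f \<in> TV"
  shows "(\<lambda>l. \<Sum>(p, r)\<in>supp (cop act q f). cop act q f (p, r) * wd p l * derivs w (wd r) []) = derivs w f"
proof -
  define d2 where "d2 = rec_list (\<lambda>t. t) (\<lambda>y w F t. F (deriv2 y t))"
  have d2_simps: "d2 [] t = t" "d2 (y # w) t = d2 w (deriv2 y t)" for t y w by (simp_all add: d2_def)
  have lin: "lin (d2 w)" for w
  proof (induction w)
    case (Cons y w)
    then show ?case using lin_comp[OF Cons lin_deriv2] by (simp add: d2_simps)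
  qed (simp add: d2_simps lin_id)
  have tens: "d2 w (tens P R) = tens P (derivs w R)" if "fsupp P" "fsupp R" for P R w
    using that by (induction w arbitrary: R) (simp_all add: d2_simps deriv2_tens)
  have cop: "d2 w (cop act q f) = cop act q (derivs w f)"
    using assms by (induction w arbitrary: f) (simp_all add: d2_simps deriv2_cop deriv_TV)
  let ?t = "cop act q f"
  have fs: "fsupp ?t" using cop_TT assms TT_fsupp by blast
  have "d2 w ?t = (\<lambda>z. \<Sum>k\<in>supp ?t. ?t k * tens (wd (fst k)) (derivs w (wd (snd k))) z)"
  proof -
    have "?t = (\<lambda>z. \<Sum>k\<in>supp ?t. ?t k * tens (wd (fst k)) (wd (snd k)) z)"
    proof
      fix z
      have "(\<Sum>k\<in>supp ?t. ?t k * wd k z) = (\<Sum>k\<in>supp ?t. if k = z then ?t k else 0)"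
        by (rule sum.cong) (auto simp: wd_def)
      also have "\<dots> = ?t z" using fs by (simp add: supp_def)
      finally show "?t z = (\<Sum>k\<in>supp ?t. ?t k * tens (wd (fst k)) (wd (snd k)) z)"
        by (simp add: tens_wd)
    qed
    then have "d2 w ?t = d2 w (\<lambda>z. \<Sum>k\<in>supp ?t. ?t k * tens (wd (fst k)) (wd (snd k)) z)" by (rule arg_cong)
    also have "\<dots> = (\<lambda>z. \<Sum>k\<in>supp ?t. d2 w (\<lambda>z. ?t k * tens (wd (fst k)) (wd (snd k)) z) z)"
      by (rule lin_sum[OF lin fs]) simp
    finally show ?thesis by (simp add: lin_smult[OF lin] tens)
  qed
  then have "(\<lambda>l. cop act q (derivs w f) (l, [])) =
      (\<lambda>l. \<Sum>(p, r)\<in>supp ?t. ?t (p, r) * wd p l * derivs w (wd r) [])"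
    unfolding cop by (simp add: tens_def case_prod_beta mult.assoc)
  moreover have "fsupp (derivs w f)" using assms TV_fsupp lin_fsupp[OF lin_derivs] by blast
  ultimately show ?thesis using counit_cop by metis
qed

lemma derivs_NI: "f \<in> NI \<Longrightarrow> derivs w f \<in> NI"
  by (induction w arbitrary: f) (simp_all add: deriv_NI)

text \<open>The pairings required by \<open>tsum_eliminate\<close> are the iterated derivatives of
  \<open>f\<close>, by \<open>slice_derivs\<close>, and they stay in the ideal.\<close>

theorem cop_NI:
  assumes "f \<in> NI" shows "cop act q f \<in> tsum NI"
proof -
  let ?t = "cop act q f"
  have t: "?t \<in> TT" using cop_TT assms NI_TV by blast
  have "(\<lambda>z. \<Sum>k\<in>supp ?t. tens (\<lambda>l. ?t k * wd (fst k) l) (wd (snd k)) z) \<in> tsum NI"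
  proof (rule tsum_eliminate)
    fix w
    show "(\<lambda>l. \<Sum>k\<in>supp ?t. ?t k * wd (fst k) l * derivs w (wd (snd k)) []) \<in> NI"
      using slice_derivs[OF NI_TV[OF assms], of w] derivs_NI[OF assms, of w]
      by (simp add: case_prod_beta)
  qed (use t in \<open>auto simp: TT_def intro!: subsp_smult[OF subsp_TV]\<close>)
  moreover have "(\<Sum>k\<in>supp ?t. tens (\<lambda>l. ?t k * wd (fst k) l) (wd (snd k)) z) = ?t z" for z
  proof -
    have "(\<Sum>k\<in>supp ?t. tens (\<lambda>l. ?t k * wd (fst k) l) (wd (snd k)) z) = (\<Sum>k\<in>supp ?t. if k = z then ?t k else 0)"
      by (rule sum.cong) (auto simp: wd_def tens_def split: prod.splits)
    also have "\<dots> = ?t z" using TT_fsupp[OF t] by (simp add: supp_def)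
    finally show ?thesis .
  qed
  ultimately show ?thesis by simp
qed

lemma gacts_TV: "r \<in> lists X \<Longrightarrow> f \<in> TV \<Longrightarrow> gacts r f \<in> TV"
  by (induction r) (simp_all add: gact_TV)

lemma gacts_NI: "r \<in> lists X \<Longrightarrow> f \<in> NI \<Longrightarrow> gacts r f \<in> NI"
  by (induction r) (simp_all add: gact_NI)

text \<open>Homogeneity is measured by the operators on T(V) rather than by degrees in the
  enveloping group, as the braided product only sees these operators.\<close>

definition act_homog :: "('x list \<Rightarrow> 'k) \<Rightarrow> bool" where
  "act_homog R \<longleftrightarrow> (\<forall>r\<in>supp R. \<forall>r'\<in>supp R. \<forall>f\<in>TV. gacts r f = gacts r' f)"

lemma act_homog_tmul:
  assumes "act_homog R" "act_homog R'" "R' \<in> TV"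
  shows "act_homog (tmul R R')"
  unfolding act_homog_def
proof (intro ballI)
  fix w w' f assume w: "w \<in> supp (tmul R R')" "w' \<in> supp (tmul R R')" and f: "f \<in> TV"
  obtain r s where "w = r @ s" "r \<in> supp R" "s \<in> supp R'"
    using subsetD[OF supp_tmul w(1)] by auto
  moreover obtain r' s' where "w' = r' @ s'" "r' \<in> supp R" "s' \<in> supp R'"
    using subsetD[OF supp_tmul w(2)] by auto
  ultimately have *: "w = r @ s" "w' = r' @ s'" "r \<in> supp R" "s \<in> supp R'" "r' \<in> supp R" "s' \<in> supp R'"
    by auto
  have "s \<in> lists X" using *(4) assms(3) unfolding TV_def by blast
  then have "gacts s f \<in> TV" using gacts_TV f by blast
  then have "gacts r (gacts s f) = gacts r' (gacts s f)"
    using assms(1) *(3,5) unfolding act_homog_def by blast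
  moreover have "gacts s f = gacts s' f" using assms(2) *(4,6) f unfolding act_homog_def by blast
  ultimately show "gacts w f = gacts w' f" by (simp add: *(1,2) gacts_append)
qed

text \<open>If \<open>P\<close> is in the ideal, \<open>R\<close> may be expanded into words, each
  giving a left factor in the ideal. Otherwise \<open>R\<close> is homogeneous, and one word
  \<open>r0\<close> of its support represents the action of all, so the product is the pure tensor
  of \<open>tmul P (gacts r0 P')\<close> and \<open>tmul R R'\<close>.\<close>

lemma mul2_tens_tsum:
  assumes M: "M \<subseteq> TV" "\<And>R. R \<in> M \<Longrightarrow> act_homog R" "\<And>R R'. R \<in> M \<Longrightarrow> R' \<in> M \<Longrightarrow> tmul R R' \<in> M"
    and s: "P \<in> TV \<and> R \<in> M \<or> P \<in> NI \<and> R \<in> TV" and t: "P' \<in> TV \<and> R' \<in> M \<or> P' \<in> NI \<and> R' \<in> TV"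
  shows "mul2 (tens P R) (tens P' R') \<in> tsum M"
proof -
  have TV: "P \<in> TV" "R \<in> TV" "P' \<in> TV" "R' \<in> TV" using s t M(1) NI_TV by auto
  then have fs: "fsupp P" "fsupp R" "fsupp P'" "fsupp R'" using TV_fsupp by auto
  have lin: "lin (\<lambda>R. mul2 (tens P R) (tens P' R'))"
    by (rule lin_comp[OF lin_mul2_left lin_tens_right]) (use fs in auto)
  show ?thesis
  proof (cases "P \<in> NI")
    case True
    show ?thesis
    proof (rule TV_lin[OF lin _ subsp_tsum TV(2)])
      fix r assume "r \<in> lists X"
      then show "mul2 (tens P (wd r)) (tens P' R') \<in> tsum M"
        using True TV fs gacts_TV[of r P'] mul2_tens[of P P' R' r]
        by (auto simp del: in_lists_conv_set intro!: tsum.left tmul_NI tmul_TV)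
    qed
  next
    case False
    then have R: "R \<in> M" using s by blast
    show ?thesis
    proof (cases "supp R = {}")
      case True
      then have "R = (\<lambda>_. 0)" by (auto simp: supp_def)
      then show ?thesis using lin_zero[OF lin] tsum.zero by simp
    next
      case False
      then obtain r0 where r0: "r0 \<in> supp R" by blast
      then have X0: "r0 \<in> lists X" using TV(2) unfolding TV_def by blast
      let ?P = "tmul P (gacts r0 P')"
      have "mul2 (tens P R) (tens P' R') = tens ?P (tmul R R')"
      proof (rule lin_ext[OF lin, of "\<lambda>R. tens ?P (tmul R R')" "supp R"])
        show "lin (\<lambda>R. tens ?P (tmul R R'))"
          by (rule lin_comp[OF lin_tens_right lin_tmul_left]) (use fs in auto)
        fix r assume "r \<in> supp R"
        then have "gacts r P' = gacts r0 P'" using M(2)[OF R] r0 TV(3) unfolding act_homog_def by blast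
        then show "mul2 (tens P (wd r)) (tens P' R') = tens ?P (tmul (wd r) R')"
          using fs by (simp add: mul2_tens)
      qed (use fs in auto)
      moreover have "tens ?P (tmul R R') \<in> tsum M"
      proof (cases "P' \<in> NI")
        case True
        then show ?thesis using TV X0 by (intro tsum.left tmul_NI tmul_TV) (simp_all add: gacts_NI)
      next
        case False
        then show ?thesis using TV X0 t R M(3) by (intro tsum.right tmul_TV) (auto intro: gacts_TV)
      qed
      ultimately show ?thesis by simp
    qed
  qed
qed

lemma mul2_tsum:
  assumes M: "M \<subseteq> TV" "\<And>R. R \<in> M \<Longrightarrow> act_homog R" "\<And>R R'. R \<in> M \<Longrightarrow> R' \<in> M \<Longrightarrow> tmul R R' \<in> M"
    and s: "s \<in> tsum M" and t: "t \<in> tsum M"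
  shows "mul2 s t \<in> tsum M"
proof -
  note fs = tsum_fsupp[OF M(1)]
  have *: "mul2 (tens P R) t \<in> tsum M" if PR: "P \<in> TV \<and> R \<in> M \<or> P \<in> NI \<and> R \<in> TV" for P R
    using t
  proof (induction rule: tsum.induct)
    have lin: "lin (mul2 (tens P R))"
      using PR M(1) NI_TV TV_fsupp by (intro lin_mul2_right fsupp_tens) auto
    {
      case zero
      show ?case using lin_zero[OF lin] tsum.zero by simp
    next
      case (add s t)
      then show ?case
        using lin_add[OF lin fs[OF add.hyps(1)] fs[OF add.hyps(2)]] tsum.add by simp
    }
  qed (use mul2_tens_tsum[OF M PR] in blast)+
  show ?thesis
    using s
  proof (induction rule: tsum.induct)
    have lin: "lin (\<lambda>s. mul2 s t)" using fs[OF t] lin_mul2_left by blast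
    {
      case zero
      show ?case using lin_zero[OF lin] tsum.zero by simp
    next
      case (add s s')
      have "mul2 (\<lambda>z. s z + s' z) t = (\<lambda>z. mul2 s t z + mul2 s' t z)"
        by (rule lin_add[OF lin fs[OF add.hyps(1)] fs[OF add.hyps(2)]])
      then show ?case using add tsum.add by simp
    }
  qed (use * in blast)+
qed

text \<open>The witness \<open>H\<close> keeps the pure tensors with right factor in
  \<open>M\<close> and replaces those with left factor in the ideal by 0.\<close>

lemma tsum_slices:
  assumes "t \<in> tsum M" and M: "M \<subseteq> TV" "subsp M"
  shows "\<exists>H. finite (supp H) \<and> supp H \<subseteq> lists X \<times> lists X \<and> (\<forall>l. (\<lambda>r. H (l, r)) \<in> M) \<and>
    (\<forall>r. nichols_zero act q (\<lambda>l. t (l, r) - H (l, r)))"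
proof -
  have "\<exists>H\<in>TT. (\<forall>l. (\<lambda>r. H (l, r)) \<in> M) \<and> (\<forall>r. (\<lambda>l. t (l, r) - H (l, r)) \<in> NI)"
    using assms(1)
  proof (induction rule: tsum.induct)
    case zero
    show ?case
      by (rule bexI[of _ "\<lambda>_. 0"])
        (use subsp_zero[OF M(2)] subsp_zero[OF subsp_NI] subsp_zero[OF subsp_TT] in auto)
  next
    case (add s t)
    then obtain H H' where H: "H \<in> TT" "\<forall>l. (\<lambda>r. H (l, r)) \<in> M" "\<forall>r. (\<lambda>l. s (l, r) - H (l, r)) \<in> NI"
      "H' \<in> TT" "\<forall>l. (\<lambda>r. H' (l, r)) \<in> M" "\<forall>r. (\<lambda>l. t (l, r) - H' (l, r)) \<in> NI" by blast
    have "(\<lambda>l. s (l, r) + t (l, r) - (H (l, r) + H' (l, r))) =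
        (\<lambda>l. (s (l, r) - H (l, r)) + (t (l, r) - H' (l, r)))" for r by auto
    then have "(\<lambda>l. s (l, r) + t (l, r) - (H (l, r) + H' (l, r))) \<in> NI" for r
      using subsp_add[OF subsp_NI] H(3,6) by simp
    then show ?case
      using H subsp_add[OF subsp_TT] subsp_add[OF M(2)] by (intro bexI[of _ "\<lambda>z. H z + H' z"]) auto
  next
    case (right P R)
    have "(\<lambda>r. tens P R (l, r)) \<in> M" for l
      using subsp_smult[OF M(2) right.hyps(2)] by (simp add: tens_def)
    then show ?case
      using right M(1) tens_TT subsp_zero[OF subsp_NI] by (intro bexI[of _ "tens P R"]) auto
  next
    case (left P R)
    have "(\<lambda>l. tens P R (l, r)) \<in> NI" for r
      using subsp_smult[OF subsp_NI left.hyps(1), of "R r"] by (simp add: tens_def mult.commute)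
    then show ?case
      using subsp_zero[OF M(2)] subsp_zero[OF subsp_TT] by (intro bexI[of _ "\<lambda>_. 0"]) auto
  qed
  then show ?thesis unfolding TT_def NI_iff by blast
qed

end

section \<open>Generated subalgebras\<close>

lemma subsp_gen_alg: "subsp (gen_alg A)"
proof -
  have "(\<lambda>w. 0 * wd [] w) \<in> gen_alg A" by (intro gen_alg.smult gen_alg.unit)
  then show ?thesis unfolding subsp_def by (auto intro: gen_alg.add gen_alg.smult)
qed

lemma gen_alg_support:
  assumes "f \<in> gen_alg A" "\<And>g. g \<in> A \<Longrightarrow> fsupp g \<and> supp g \<subseteq> lists Y"
  shows "fsupp f \<and> supp f \<subseteq> lists Y"
  using assms(1)
proof (induction rule: gen_alg.induct)
  case unit
  then show ?case by (simp add: supp_wd)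
next
  case (add f g)
  then show ?case using supp_add[of f g] by auto
next
  case (smult f k)
  then show ?case using supp_smult[of k f] by auto
next
  case (mult f g)
  then show ?case using supp_tmul[of f g] by fastforce
qed (use assms(2) in blast)

lemma same_deg_sym: "same_deg X act u v \<Longrightarrow> same_deg X act v u"
  unfolding same_deg_def by (rule gx_eq.sym)

lemma same_deg_trans: "same_deg X act u v \<Longrightarrow> same_deg X act v w \<Longrightarrow> same_deg X act u w"
  unfolding same_deg_def by (rule gx_eq.trans)

lemma same_deg_append:
  assumes "same_deg X act u u'" "same_deg X act v v'"
  shows "same_deg X act (u @ v) (u' @ v')"
proof -
  let ?m = "map (\<lambda>x. (x, True))"
  have "gx_eq X act ([] @ ?m u @ ?m v) ([] @ ?m u' @ ?m v)"
    using assms(1) unfolding same_deg_def by (rule gx_eq.ctxt)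
  moreover have "gx_eq X act (?m u' @ ?m v @ []) (?m u' @ ?m v' @ [])"
    using assms(2) unfolding same_deg_def by (rule gx_eq.ctxt)
  ultimately show ?thesis unfolding same_deg_def by (auto intro: gx_eq.trans)
qed

lemma same_deg_braid:
  assumes "x \<in> X" "y \<in> X"
  shows "same_deg X act (p @ [x, y] @ s) (p @ [act x y, x] @ s)"
proof -
  let ?m = "map (\<lambda>x. (x, True))"
  have "gx_eq X act (?m p @ [(x, True), (y, True)] @ ?m s) (?m p @ [(act x y, True), (x, True)] @ ?m s)"
    by (rule gx_eq.ctxt[OF gx_eq.rel[OF assms]])
  then show ?thesis by (simp add: same_deg_def)
qed

text \<open>Length is recorded beside the group degree, so that one notion serves both gradings of
  the comodule category.\<close>

definition deg_homog :: "'x set \<Rightarrow> ('x \<Rightarrow> 'x \<Rightarrow> 'x) \<Rightarrow> ('x list \<Rightarrow> 'k::zero) \<Rightarrow> bool" where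
  "deg_homog X act f \<longleftrightarrow> (\<forall>w\<in>supp f. \<forall>w'\<in>supp f. length w = length w' \<and> same_deg X act w w')"

lemma deg_homog_tmul:
  assumes "deg_homog X act f" "deg_homog X act g"
  shows "deg_homog X act (tmul f (g :: _ \<Rightarrow> 'k::comm_ring_1))"
  unfolding deg_homog_def
proof (intro ballI)
  fix w w' assume w: "w \<in> supp (tmul f g)" "w' \<in> supp (tmul f g)"
  obtain u v where 1: "w = u @ v" "u \<in> supp f" "v \<in> supp g"
    using subsetD[OF supp_tmul w(1)] by auto
  obtain u' v' where 2: "w' = u' @ v'" "u' \<in> supp f" "v' \<in> supp g"
    using subsetD[OF supp_tmul w(2)] by auto
  have "length u = length u' \<and> same_deg X act u u'" "length v = length v' \<and> same_deg X act v v'"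
    using assms 1(2,3) 2(2,3) unfolding deg_homog_def by blast+
  then show "length w = length w' \<and> same_deg X act w w'"
    by (simp add: 1(1) 2(1) same_deg_append)
qed

inductive_set hsum :: "'x set \<Rightarrow> ('x \<Rightarrow> 'x \<Rightarrow> 'x) \<Rightarrow> ('x list \<Rightarrow> 'k::comm_ring_1) set \<Rightarrow> ('x list \<Rightarrow> 'k) set"
  for X act A where
  homog: "f \<in> gen_alg A \<Longrightarrow> deg_homog X act f \<Longrightarrow> f \<in> hsum X act A"
| add: "f \<in> hsum X act A \<Longrightarrow> g \<in> hsum X act A \<Longrightarrow> (\<lambda>w. f w + g w) \<in> hsum X act A"

lemma hsum_tmul:
  assumes "f \<in> hsum X act A" "g \<in> hsum X act A" shows "tmul f g \<in> hsum X act A"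
  using assms(1)
proof (induction rule: hsum.induct)
  case (homog f)
  show ?case using assms(2)
  proof (induction rule: hsum.induct)
    case (homog g)
    then show ?case using \<open>f \<in> gen_alg A\<close> \<open>deg_homog X act f\<close> by (intro hsum.homog gen_alg.mult deg_homog_tmul)
  next
    case (add g g')
    have "tmul f (\<lambda>w. g w + g' w) = (\<lambda>w. tmul f g w + tmul f g' w)"
      by (simp add: tmul_def distrib_left sum.distrib)
    then show ?case using hsum.add[OF add.IH] by simp
  qed
next
  case (add f f')
  have "tmul (\<lambda>w. f w + f' w) g = (\<lambda>w. tmul f g w + tmul f' g w)"
    by (simp add: tmul_def distrib_right sum.distrib)
  then show ?case using hsum.add[OF add.IH] by simp
qed

lemma gen_alg_hsum:
  assumes "\<And>f. f \<in> A \<Longrightarrow> deg_homog X act f" "f \<in> gen_alg A"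
  shows "f \<in> hsum X act A"
  using assms(2)
proof (induction rule: gen_alg.induct)
  case unit
  show ?case
    by (intro hsum.homog gen_alg.unit) (simp add: deg_homog_def supp_wd same_deg_def gx_eq.refl)
next
  case (base f)
  then show ?case using assms(1) by (intro hsum.homog gen_alg.base)
next
  case (add f g)
  show ?case by (rule hsum.add[OF add.IH])
next
  case (smult f k)
  show ?case using smult.IH
  proof (induction rule: hsum.induct)
    case (homog f)
    have "deg_homog X act (\<lambda>w. k * f w)"
      using homog(2) supp_smult[of k f] unfolding deg_homog_def by blast
    then show ?case using homog by (intro hsum.homog gen_alg.smult)
  next
    case (add f g)
    then show ?case using hsum.add[OF add.IH] by (simp add: distrib_left)
  qed
next
  case (mult f g)
  show ?case by (rule hsum_tmul[OF mult.IH])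
qed

text \<open>A subalgebra with homogeneous generators consists of sums of its homogeneous elements.
  The predicate is constant on the support of each summand, so restriction keeps it or kills
  it.\<close>

lemma gen_alg_restrict:
  assumes A: "\<And>f. f \<in> A \<Longrightarrow> deg_homog X act f"
    and P: "\<And>w w'. length w = length w' \<Longrightarrow> same_deg X act w w' \<Longrightarrow> P w = P w'"
    and f: "f \<in> gen_alg A"
  shows "(\<lambda>w. if P w then f w else 0) \<in> gen_alg A"
proof -
  have "f \<in> hsum X act A" by (rule gen_alg_hsum) (use A f in auto)
  then show ?thesis
  proof (induction rule: hsum.induct)
    case (homog f)
    have "(\<lambda>w. if P w then f w else 0) = f \<or> (\<lambda>w. if P w then f w else 0) = (\<lambda>_. 0)"
    proof (cases "\<exists>w\<in>supp f. P w")
      case True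
      then have "\<forall>w\<in>supp f. P w" using homog(2) P unfolding deg_homog_def by blast
      then show ?thesis by (auto simp: supp_def fun_eq_iff)
    next
      case False
      then show ?thesis by (auto simp: supp_def fun_eq_iff)
    qed
    then show ?case using homog(1) subsp_zero[OF subsp_gen_alg] by metis
  next
    case (add f g)
    have "(\<lambda>w. if P w then f w + g w else 0) = (\<lambda>w. (if P w then f w else 0) + (if P w then g w else 0))"
      by auto
    then show ?case using gen_alg.add[OF add.IH] by simp
  qed
qed

lemma hom_one_tmul: "hom 1 (tmul f g) = (\<lambda>w. f [] * hom 1 g w + g [] * hom 1 f (w :: 'a list) :: 'k::comm_ring_1)"
proof
  fix w :: "'a list"
  show "hom 1 (tmul f g) w = f [] * hom 1 g w + g [] * hom 1 f w"
    by (cases w; cases "tl w") (auto simp: hom_def tmul_Cons mult.commute)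
qed

text \<open>By \<open>hom_one_tmul\<close> the projection to degree one is a derivation relative to
  the counit. A generator without a degree one part therefore never contributes.\<close>

lemma gen_alg_hom_one:
  assumes "u \<in> gen_alg (insert Z S)" "hom 1 Z = (\<lambda>_. 0)" "\<And>s. s \<in> S \<Longrightarrow> hom 1 s = s"
  shows "hom 1 u \<in> gen_alg S"
  using assms(1)
proof (induction rule: gen_alg.induct)
  case unit
  show ?case using subsp_zero[OF subsp_gen_alg] by (simp add: hom_wd)
next
  case (base f)
  then show ?case using assms(2,3) subsp_zero[OF subsp_gen_alg, of S] gen_alg.base[of f S] by auto
next
  case (add f g)
  have "hom 1 (\<lambda>w. f w + g w) = (\<lambda>w. hom 1 f w + hom 1 g w)" by (auto simp: hom_def)
  then show ?case using gen_alg.add[OF add.IH] by simp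
next
  case (smult f k)
  have "hom 1 (\<lambda>w. k * f w) = (\<lambda>w. k * hom 1 f w)" by (auto simp: hom_def)
  then show ?case using gen_alg.smult[OF smult.IH] by simp
next
  case (mult f g)
  then show ?case unfolding hom_one_tmul by (intro gen_alg.add gen_alg.smult)
qed

context braiding
begin

lemma deriv_at_Nil:
  assumes "fsupp f" shows "deriv y f [] = f [y]"
proof -
  have "(\<lambda>w. if w = [] then deriv y f w else 0) = (\<lambda>w. if w = [] then f ([] @ [y]) else 0)"
  proof (rule lin_ext_UNIV[OF lin_comp[OF lin_restrict lin_deriv] _ _ assms])
    have "lin (\<lambda>f w. if w = [] then f (w @ [y]) else (0::'k))"
      by (rule lin_comp[OF lin_restrict lin_last])
    moreover have "(\<lambda>f w. if w = [] then f ([] @ [y]) else (0::'k)) = (\<lambda>f w. if w = [] then f (w @ [y]) else 0)"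
      by (intro ext) simp
    ultimately show "lin (\<lambda>f w. if (w :: 'x list) = [] then f ([] @ [y]) else (0::'k))" by metis
    fix u
    have "deriv_word y u [] = wd u [y]"
      by (cases u) (auto simp: tmul_letter, auto simp: wd_def)
    then show "(\<lambda>w. if w = [] then deriv y (wd u) w else 0) = (\<lambda>w. if w = [] then wd u ([] @ [y]) else 0)"
      by auto
  qed
  then show ?thesis by (metis append_Nil)
qed

end

section \<open>Preimages of generated subalgebras and reduction to generators\<close>

context rack_cocycle
begin

lemma gen_alg_TV: "A \<subseteq> TV \<Longrightarrow> gen_alg A \<subseteq> TV"
  using gen_alg_support[of _ A X] unfolding TV_def by blast

lemma nsat_iff:
  assumes "A \<subseteq> TV"
  shows "f \<in> nsat act q X A \<longleftrightarrow> f \<in> TV \<and> (\<exists>u\<in>A. (\<lambda>w. f w - u w) \<in> NI)"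
proof -
  have "(\<lambda>w. f w - u w) \<in> NI \<longleftrightarrow> nichols_zero act q (\<lambda>w. f w - u w)" if "f \<in> TV" "u \<in> A" for u
    using that assms subsp_diff[OF subsp_TV] NI_iff by blast
  then show ?thesis unfolding nsat_def by (auto simp: TV_def)
qed

context
  fixes A :: "('x list \<Rightarrow> 'k) set"
  assumes A: "A \<subseteq> TV"
begin

lemma nsat_gen_iff:
  "f \<in> nsat act q X (gen_alg A) \<longleftrightarrow> f \<in> TV \<and> (\<exists>u\<in>gen_alg A. (\<lambda>w. f w - u w) \<in> NI)"
  by (rule nsat_iff[OF gen_alg_TV[OF A]])

lemma nsat_gen_TV: "nsat act q X (gen_alg A) \<subseteq> TV"
  using nsat_gen_iff by blast

lemma gen_alg_nsat: "gen_alg A \<subseteq> nsat act q X (gen_alg A)"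
proof
  fix f assume "f \<in> gen_alg A"
  moreover have "(\<lambda>w. f w - f w) \<in> NI" using subsp_zero[OF subsp_NI] by simp
  ultimately show "f \<in> nsat act q X (gen_alg A)" using gen_alg_TV[OF A] nsat_gen_iff by blast
qed

lemma NI_nsat: "NI \<subseteq> nsat act q X (gen_alg A)"
proof
  fix f assume "f \<in> NI"
  then have "(\<lambda>w. f w - 0) \<in> NI" by simp
  then show "f \<in> nsat act q X (gen_alg A)"
    unfolding nsat_gen_iff using NI_TV[OF \<open>f \<in> NI\<close>]
    by (intro conjI bexI[OF _ subsp_zero[OF subsp_gen_alg]])
qed

lemma subsp_nsat: "subsp (nsat act q X (gen_alg A))"
  unfolding subsp_def
proof (intro conjI ballI allI)
  show "(\<lambda>_. 0) \<in> nsat act q X (gen_alg A)" using NI_nsat subsp_zero[OF subsp_NI] by blast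
  fix f g k assume "f \<in> nsat act q X (gen_alg A)" "g \<in> nsat act q X (gen_alg A)"
  then obtain u v where *: "f \<in> TV" "g \<in> TV" "u \<in> gen_alg A" "(\<lambda>w. f w - u w) \<in> NI"
    "v \<in> gen_alg A" "(\<lambda>w. g w - v w) \<in> NI" unfolding nsat_gen_iff by blast
  have "(\<lambda>w. f w + k * g w - (u w + k * v w)) = (\<lambda>w. (f w - u w) + k * (g w - v w))"
    by (auto simp: algebra_simps)
  then have "(\<lambda>w. f w + k * g w - (u w + k * v w)) \<in> NI" using subsp_lincomb[OF subsp_NI *(4,6)] by simp
  then show "(\<lambda>w. f w + k * g w) \<in> nsat act q X (gen_alg A)"
    unfolding nsat_gen_iff using * subsp_lincomb[OF subsp_TV] subsp_lincomb[OF subsp_gen_alg]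
    by (intro conjI bexI[of _ "\<lambda>w. u w + k * v w"]) auto
qed

lemma tmul_nsat:
  assumes "f \<in> nsat act q X (gen_alg A)" "g \<in> nsat act q X (gen_alg A)"
  shows "tmul f g \<in> nsat act q X (gen_alg A)"
proof -
  obtain u v where *: "f \<in> TV" "g \<in> TV" "u \<in> gen_alg A" "(\<lambda>w. f w - u w) \<in> NI"
    "v \<in> gen_alg A" "(\<lambda>w. g w - v w) \<in> NI" using assms unfolding nsat_gen_iff by blast
  have TV: "u \<in> TV" "v \<in> TV" using * gen_alg_TV[OF A] by auto
  have "(\<lambda>w. tmul f g w - tmul u v w) = (\<lambda>w. tmul f (\<lambda>w. g w - v w) w + tmul (\<lambda>w. f w - u w) v w)"
    using * TV TV_fsupp by (simp add: lin_diff[OF lin_tmul_left] lin_diff[OF lin_tmul_right])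
  moreover have "tmul f (\<lambda>w. g w - v w) \<in> NI" "tmul (\<lambda>w. f w - u w) v \<in> NI"
    using * TV by (auto intro: tmul_NI)
  ultimately have "(\<lambda>w. tmul f g w - tmul u v w) \<in> NI" using subsp_add[OF subsp_NI] by simp
  then show ?thesis using * nsat_gen_iff tmul_TV gen_alg.mult by blast
qed

lemma gen_alg_nsat_subset:
  assumes "E \<subseteq> nsat act q X (gen_alg A)"
  shows "nsat act q X (gen_alg E) \<subseteq> nsat act q X (gen_alg A)"
proof
  have E: "E \<subseteq> TV" using assms nsat_gen_TV by blast
  fix f assume "f \<in> nsat act q X (gen_alg E)"
  then obtain u where u: "f \<in> TV" "u \<in> gen_alg E" "(\<lambda>w. f w - u w) \<in> NI"
    using nsat_iff[OF gen_alg_TV[OF E]] by blast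
  have "u \<in> nsat act q X (gen_alg A)"
    using u(2)
  proof (induction rule: gen_alg.induct)
    case unit
    show ?case using gen_alg.unit gen_alg_nsat by blast
  qed (use assms subsp_add[OF subsp_nsat] subsp_smult[OF subsp_nsat] tmul_nsat in blast)+
  moreover have "(\<lambda>w. f w - u w) \<in> nsat act q X (gen_alg A)" using u NI_nsat by blast
  ultimately have "(\<lambda>w. u w + (f w - u w)) \<in> nsat act q X (gen_alg A)"
    using subsp_add[OF subsp_nsat] by blast
  then show "f \<in> nsat act q X (gen_alg A)" by simp
qed

lemma restrict_nsat:
  assumes hom: "\<And>f. f \<in> A \<Longrightarrow> deg_homog X act f"
    and P: "\<And>w w'. length w = length w' \<Longrightarrow> same_deg X act w w' \<Longrightarrow> P w = P w'"
    and f: "f \<in> nsat act q X (gen_alg A)"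
  shows "(\<lambda>w. if P w then f w else 0) \<in> nsat act q X (gen_alg A)"
proof -
  obtain u where u: "f \<in> TV" "u \<in> gen_alg A" "(\<lambda>w. f w - u w) \<in> NI"
    using f unfolding nsat_gen_iff by blast
  have "braid_inv P"
    unfolding braid_inv_def by (intro allI ballI P same_deg_braid) simp_all
  then have "(\<lambda>w. if P w then f w - u w else 0) \<in> NI" using restrict_NI[OF _ u(3)] by simp
  moreover have "(\<lambda>w. (if P w then f w else 0) - (if P w then u w else 0)) =
      (\<lambda>w. if P w then f w - u w else 0)" by auto
  moreover have "(\<lambda>w. if P w then u w else 0) \<in> gen_alg A"
    by (rule gen_alg_restrict[OF hom P u(2)])
  ultimately show ?thesis unfolding nsat_gen_iff using restrict_TV[OF u(1)] by (intro conjI bexI) auto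
qed

theorem left_coideal_subalg_generated:
  assumes homog: "\<And>f. f \<in> A \<Longrightarrow> deg_homog X act f \<and> act_homog f"
    and cop: "\<And>f. f \<in> A \<Longrightarrow> cop act q f \<in> tsum {R \<in> nsat act q X (gen_alg A). act_homog R}"
  shows "left_coideal_subalg act q X (nsat act q X (gen_alg A))"
proof -
  define C where "C = nsat act q X (gen_alg A)"
  \<comment> \<open>\<open>M\<close> is closed under products only; sums are supplied by
    \<open>tsum\<close>. Working with \<open>C\<close> in place of \<open>M\<close> would break the
    product step.\<close>
  define M where "M = {R \<in> C. act_homog R}"
  have C: "C \<subseteq> TV" "subsp C" using nsat_gen_TV subsp_nsat by (simp_all add: C_def)
  have M: "M \<subseteq> TV" "\<And>R. R \<in> M \<Longrightarrow> act_homog R" "\<And>R R'. R \<in> M \<Longrightarrow> R' \<in> M \<Longrightarrow> tmul R R' \<in> M"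
    using C tmul_nsat act_homog_tmul unfolding M_def C_def by auto
  have unit: "wd [] \<in> C" using gen_alg.unit gen_alg_nsat unfolding C_def by blast
  have "cop act q u \<in> tsum M" if "u \<in> gen_alg A" for u
    using that
  proof (induction rule: gen_alg.induct)
    case unit
    have "wd [] \<in> M" using \<open>wd [] \<in> C\<close> by (simp add: M_def act_homog_def supp_wd)
    then show ?case using tsum.right[of "wd []" "wd []" M] by (simp add: tens_wd)
  next
    case (base f)
    then show ?case using cop unfolding M_def C_def by simp
  next
    case (add f g)
    then have "fsupp f" "fsupp g" using gen_alg_TV[OF A] TV_fsupp by blast+
    then show ?case using tsum.add[OF add.IH] by (simp add: lin_add[OF lin_cop])
  next
    case (smult f k)
    then have "fsupp f" using gen_alg_TV[OF A] TV_fsupp by blast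
    then show ?case using tsum_smult[OF smult.IH] by (simp add: lin_smult[OF lin_cop])
  next
    case (mult f g)
    then have "fsupp f" "fsupp g" using gen_alg_TV[OF A] TV_fsupp by blast+
    then show ?case using mul2_tsum[OF M mult.IH] by (simp add: cop_tmul)
  qed
  \<comment> \<open>A general \<open>f\<close> differs from an element \<open>u\<close> of the
    generated algebra by an element of the ideal, whose coproduct is covered by
    \<open>cop_NI\<close>.\<close>
  then have copC: "cop act q f \<in> tsum C" if fC: "f \<in> C" for f
  proof -
    obtain u where u: "f \<in> TV" "u \<in> gen_alg A" "(\<lambda>w. f w - u w) \<in> NI"
      using fC unfolding C_def nsat_gen_iff by blast
    have fs: "fsupp u" "fsupp (\<lambda>w. f w - u w)" using u gen_alg_TV[OF A] NI_TV TV_fsupp by blast+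
    have "cop act q (\<lambda>w. f w - u w) \<in> tsum C"
      by (rule tsum_mono[OF cop_NI[OF u(3)]]) (use NI_nsat in \<open>simp add: C_def\<close>)
    moreover have "cop act q u \<in> tsum C"
      by (rule tsum_mono[OF \<open>\<And>u. u \<in> gen_alg A \<Longrightarrow> cop act q u \<in> tsum M\<close>[OF u(2)]]) (simp add: M_def)
    ultimately have "(\<lambda>z. cop act q u z + cop act q (\<lambda>w. f w - u w) z) \<in> tsum C" by (rule tsum.add[rotated])
    moreover have "cop act q (\<lambda>w. u w + (f w - u w)) = (\<lambda>z. cop act q u z + cop act q (\<lambda>w. f w - u w) z)"
      by (rule lin_add[OF lin_cop fs])
    ultimately show ?thesis by simp
  qed
  show ?thesis
    unfolding left_coideal_subalg_def C_def[symmetric]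
  proof (intro conjI ballI allI)
    fix f n assume "f \<in> C"
    then show "hom n f \<in> C"
      unfolding hom_def C_def by (intro restrict_nsat) (use homog in auto)
  next
    fix f w0 assume "f \<in> C"
    then show "(\<lambda>w. if same_deg X act w w0 then f w else 0) \<in> C"
      unfolding C_def
      by (intro restrict_nsat) (use homog same_deg_trans same_deg_sym in blast)+
  next
    fix f assume "f \<in> C"
    then show "\<exists>H. finite (supp H) \<and> supp H \<subseteq> lists X \<times> lists X \<and> (\<forall>l. (\<lambda>r. H (l, r)) \<in> C) \<and>
       (\<forall>r. nichols_zero act q (\<lambda>l. cop act q f (l, r) - H (l, r)))"
      by (rule tsum_slices[OF copC C])
  qed (use unit subsp_add[OF C(2)] subsp_smult[OF C(2)] tmul_nsat in \<open>auto simp: C_def\<close>)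
qed

end

text \<open>The degree one part of the Nichols algebra is V itself: a single derivation by
  \<open>y\<close> reads off the coefficient of the letter \<open>y\<close>.\<close>

lemma NI_hom_one: "f \<in> NI \<Longrightarrow> hom 1 f = (\<lambda>_. 0)"
proof
  fix w assume f: "f \<in> NI"
  have "derivs [y] f [] = 0" for y using f unfolding NI_def by blast
  then have "f [y] = 0" for y
    using deriv_at_Nil[OF TV_fsupp[OF NI_TV[OF f]], of y] by simp
  then show "hom 1 f w = 0" by (cases w; cases "tl w") (auto simp: hom_def)
qed

text \<open>An element of the larger subalgebra that is congruent to a degree one vector is
  congruent to its own degree one part, and this part comes from \<open>S\<close> alone, as
  \<open>Z\<close> has none.\<close>

lemma not_gen_in_deg_one:
  assumes S: "\<And>s. s \<in> S \<Longrightarrow> s \<in> TV \<and> hom 1 s = s" and Z: "Z \<in> TV" "hom 1 Z = (\<lambda>_. 0)"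
    and ZS: "Z \<notin> nsat act q X (gen_alg S)"
  shows "\<not> gen_in_deg_one act q X (nsat act q X (gen_alg (insert Z S)))"
proof
  define C where "C = nsat act q X (gen_alg (insert Z S))"
  define E where "E = {f\<in>C. \<exists>u. (\<forall>w\<in>supp u. length w = 1) \<and> nichols_zero act q (\<lambda>w. f w - u w)}"
  assume "gen_in_deg_one act q X (nsat act q X (gen_alg (insert Z S)))"
  then have CE: "C = nsat act q X (gen_alg E)" unfolding gen_in_deg_one_def C_def E_def .
  have A: "insert Z S \<subseteq> TV" "S \<subseteq> TV" using S Z by auto
  have "E \<subseteq> nsat act q X (gen_alg S)"
  proof
    fix f assume "f \<in> E"
    then obtain u0 where u0: "f \<in> C" "\<And>w. u0 w \<noteq> 0 \<Longrightarrow> length w = 1" "nichols_zero act q (\<lambda>w. f w - u0 w)"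
      unfolding E_def supp_def by blast
    obtain u where u: "f \<in> TV" "u \<in> gen_alg (insert Z S)" "(\<lambda>w. f w - u w) \<in> NI"
      using u0(1) unfolding C_def nsat_gen_iff[OF A(1)] by blast
    have "hom 1 f w - hom 1 u w = 0" for w
      using fun_cong[OF NI_hom_one[OF u(3)], of w] by (simp add: hom_def split: if_splits)
    then have "hom 1 f = hom 1 u" by auto
    then have hf: "hom 1 f \<in> gen_alg S" using gen_alg_hom_one[OF u(2) Z(2)] S by simp
    \<comment> \<open>In degree one the difference is literally 0. In every other degree
      \<open>hom 1 f\<close> and \<open>u0\<close> both vanish, so \<open>f - u0\<close> may be used
      instead.\<close>
    have "qsym act q n (hom n (\<lambda>w. f w - hom 1 f w)) = (\<lambda>_. 0)" for n
    proof (cases "n = 1")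
      case True
      then have "hom n (\<lambda>w. f w - hom 1 f w) = (\<lambda>_. 0)" by (auto simp: hom_def)
      then show ?thesis using lin_zero[OF lin_qsym] by metis
    next
      case False
      then have "hom n (\<lambda>w. f w - hom 1 f w) = hom n (\<lambda>w. f w - u0 w)"
        using u0(2) by (auto simp: hom_def fun_eq_iff)
      then show ?thesis using u0(3) unfolding nichols_zero_def by metis
    qed
    then have "nichols_zero act q (\<lambda>w. f w - hom 1 f w)" unfolding nichols_zero_def by blast
    moreover have "(\<lambda>w. f w - hom 1 f w) \<in> TV"
      using u(1) hf gen_alg_TV[OF A(2)] subsp_diff[OF subsp_TV] by blast
    ultimately show "f \<in> nsat act q X (gen_alg S)"
      using u(1) hf unfolding nsat_gen_iff[OF A(2)] NI_iff by blast
  qed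
  then have "C \<subseteq> nsat act q X (gen_alg S)" unfolding CE by (rule gen_alg_nsat_subset[OF A(2)])
  moreover have "Z \<in> C" using gen_alg_nsat[OF A(1)] gen_alg.base[of Z "insert Z S"] unfolding C_def by blast
  ultimately show False using ZS by blast
qed

end

section \<open>The element Z\<close>

context braiding
begin

lemma braid_0: "braid act q 0 (wd (x # y # t)) = (\<lambda>w. q x y * wd (act x y # x # t) w)"
  using braid_letters[of "[]"] by simp

lemma braid_1: "braid act q 1 (wd (z # x # y # t)) = (\<lambda>w. q x y * wd (z # act x y # x # t) w)"
  using braid_letters[of "[z]"] by simp

lemma cop_left_wd:
  "cop_left x (wd (p, r)) = (\<lambda>t. wd (x # p, r) t + qc x p * wd (map (act x) p, x # r) t)"
  unfolding cop_left_def lext_wd prod.case gact_wd by (auto simp: tens_def wd_def)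

lemma cop_word_1:
  "cop_word act q [x] = (\<lambda>t. wd ([x], []) t + wd ([], [x]) t)"
  unfolding cop_word_Cons cop_word.simps(1) cop_left_wd by simp

lemma cop_word_2:
  "cop_word act q [x, y] = (\<lambda>t. wd ([x, y], []) t + q x y * wd ([act x y], [x]) t
     + (wd ([x], [y]) t + wd ([], [x, y]) t))"
  unfolding cop_word_Cons[of x] cop_word_1
  by (simp add: lin_add[OF lin_cop_left] cop_left_wd)

lemma cop_word_3:
  "cop_word act q [x, y, z] = (\<lambda>t. wd ([x, y, z], []) t + q x y * q x z * wd ([act x y, act x z], [x]) t
     + q y z * wd ([x, act y z], [y]) t + q y z * q x (act y z) * wd ([act x (act y z)], [x, y]) t
     + wd ([x, y], [z]) t + q x y * wd ([act x y], [x, z]) t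
     + wd ([x], [y, z]) t + wd ([], [x, y, z]) t)"
  unfolding cop_word_Cons[of x] cop_word_2
  by (simp add: lin_add[OF lin_cop_left] lin_smult[OF lin_cop_left] cop_left_wd algebra_simps)

lemma deriv_word_3:
  "deriv_word z [x1, x2, x3] = (\<lambda>w. (if x3 = z then 1 else 0) * wd [x1, x2] w
     + (if x2 = z then q z x3 else 0) * wd [x1, act z x3] w
     + (if x1 = z then q z x2 * q z x3 else 0) * wd [act z x2, act z x3] w)"
  by (simp add: deriv_word_sum fun_eq_iff numeral_3_eq_3)

lemma deriv_word_2:
  "deriv_word z [x1, x2] = (\<lambda>w. (if x2 = z then 1 else 0) * wd [x1] w
     + (if x1 = z then q z x2 else 0) * wd [act z x2] w)"
  by (simp add: deriv_word_sum fun_eq_iff numeral_2_eq_2)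

lemma derivs_word_2:
  "derivs [y, x] (wd [x1, x2]) [] = (if x2 = y \<and> x1 = x then 1 else 0)
     + (if x1 = y \<and> act y x2 = x then q y x2 else 0)"
proof -
  have "derivs [y, x] (wd [x1, x2]) [] = deriv_word y [x1, x2] [x]"
    by (simp add: deriv_at_Nil del: deriv_word.simps)
  also have "\<dots> = (if x2 = y \<and> x1 = x then 1 else 0) + (if x1 = y \<and> act y x2 = x then q y x2 else 0)"
  proof -
    have "wd [u] [v] = (if u = v then 1 else (0::'k))" for u v :: 'x
      by (auto simp: wd_def)
    then show ?thesis unfolding deriv_word_2 by simp
  qed
  finally show ?thesis .
qed

text \<open>With \<open>derivs_word_2\<close> this spells out the six terms of the coefficient of
  the word \<open>[x, y, z]\<close> in the quantum symmetrization of
  \<open>[x1, x2, x3]\<close>.\<close>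

lemma derivs_word_3:
  "derivs [z, y, x] (wd [x1, x2, x3]) [] = (if x3 = z then derivs [y, x] (wd [x1, x2]) [] else 0)
     + (if x2 = z then q z x3 * derivs [y, x] (wd [x1, act z x3]) [] else 0)
     + (if x1 = z then q z x2 * q z x3 * derivs [y, x] (wd [act z x2, act z x3]) [] else 0)"
proof -
  have "derivs [z, y, x] (wd [x1, x2, x3]) = derivs [y, x] (deriv_word z [x1, x2, x3])"
    by (simp del: deriv_word.simps)
  then show ?thesis
    unfolding deriv_word_3
    by (simp add: lin_add[OF lin_derivs] lin_smult[OF lin_derivs] del: derivs.simps)
qed

end

context rack_cocycle
begin

lemma derivs_at_word_length:
  assumes "length w \<noteq> length u" shows "derivs w (wd u) [] = 0"
  using derivs_hom[of "wd u" w] assms by (simp add: hom_wd lin_zero[OF lin_derivs])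

end

section \<open>Braided racks and the relations of degree two\<close>

locale braided_slim = rack_cocycle +
  assumes idem: "x \<in> X \<Longrightarrow> act x x = x"
    and braided: "braided_rack X act"
    and slim: "slim2 act q X"
begin

lemma act_act_other:
  assumes "x \<in> X" "y \<in> X" "act x y \<noteq> y" shows "act x (act y x) = y"
  using assms braided unfolding braided_rack_def by blast

lemma noncomm_sym:
  assumes "x \<in> X" "y \<in> X" "act x y \<noteq> y" shows "act y x \<noteq> x"
  using act_act_other[OF assms] assms idem by metis

text \<open>As \<open>x\<close> fixes itself, self-distributivity turns the left side into
  \<open>act x (act y x)\<close>. Consequently c_q permutes the words \<open>[x, y]\<close>,
  \<open>[act x y, x]\<close>, \<open>[y, act x y]\<close> cyclically up to scalars.\<close>

lemma act_act_self:
  assumes "x \<in> X" "y \<in> X" "act x y \<noteq> y" shows "act (act x y) x = y"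
  using act_act_other[OF assms] act_dist[of x y x] idem assms by metis

lemma slim_comm:
  assumes "x \<in> X" "y \<in> X" "act x y = y" "y \<noteq> x"
  shows "(\<lambda>w. wd [x, y] w - q x y * wd [y, x] w) \<in> NI"
proof -
  have "nichols_zero act q (\<lambda>w. wd [x, y] w - q x y * wd [y, x] w)"
    using slim assms unfolding slim2_def by (fastforce simp: braid_0)
  moreover have "(\<lambda>w. wd [x, y] w - q x y * wd [y, x] w) \<in> TV"
    using assms by (intro subsp_diff[OF subsp_TV] subsp_smult[OF subsp_TV]) auto
  ultimately show ?thesis by (simp add: NI_iff)
qed

lemma slim_braid:
  assumes "x \<in> X" "y \<in> X" "act x y \<noteq> y"
  shows "(\<lambda>w. wd [x, y] w - q x y * wd [act x y, x] w + q x y * q (act x y) x * wd [y, act x y] w) \<in> NI"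
proof -
  have "nichols_zero act q (\<lambda>w. wd [x, y] w - braid act q 0 (wd [x, y]) w
      + braid act q 0 (braid act q 0 (wd [x, y])) w)"
    using slim assms unfolding slim2_def by blast
  then have "nichols_zero act q (\<lambda>w. wd [x, y] w - q x y * wd [act x y, x] w
      + q x y * q (act x y) x * wd [y, act x y] w)"
    using act_act_self[OF assms] by (simp add: braid_0 lin_smult[OF lin_braid] mult.assoc)
  moreover have "(\<lambda>w. wd [x, y] w - q x y * wd [act x y, x] w + q x y * q (act x y) x * wd [y, act x y] w) \<in> TV"
    using assms by (intro subsp_add[OF subsp_TV] subsp_diff[OF subsp_TV] subsp_smult[OF subsp_TV])
      (auto simp: act_closed)
  ultimately show ?thesis by (simp add: NI_iff)
qed

text \<open>Compare the coefficient of \<open>[x, y]\<close> in (1 + c)(1 - c + c^2) = 1 + c^3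
  applied to \<open>[x, y]\<close>: it is 0 by slimness, while c^3 multiplies the word by the
  product of the three cocycle values.\<close>

lemma braid_cube:
  assumes "x \<in> X" "y \<in> X" "act x y \<noteq> y"
  shows "q x y * q (act x y) x * q y (act x y) = -1"
proof -
  let ?F = "\<lambda>w. wd [x, y] w - q x y * wd [act x y, x] w + (q x y * q (act x y) x) * wd [y, act x y] w"
  have ne: "act x y \<noteq> x" "x \<noteq> y" using assms act_inj[of x y x] idem by metis+
  have "derivs [y, x] ?F [] = 0" using slim_braid[OF assms] unfolding NI_def by blast
  moreover have "derivs [y, x] ?F = (\<lambda>w. derivs [y, x] (wd [x, y]) w
      - q x y * derivs [y, x] (wd [act x y, x]) w
      + (q x y * q (act x y) x) * derivs [y, x] (wd [y, act x y]) w)"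
    by (simp only: lin_lincomb[OF lin_derivs] lin_diff[OF lin_derivs] lin_smult[OF lin_derivs]
        fsupp_wd fsupp_smult fsupp_lincomb[of _ _ "-1", simplified])
  ultimately show ?thesis
    using ne assms act_act_other[OF assms(2,1) noncomm_sym[OF assms]]
    by (simp add: derivs_word_2 del: derivs.simps) (simp add: eq_neg_iff_add_eq_0 add.commute)
qed

end

section \<open>The triple a, b, c and the coproduct of Z\<close>

locale noncomm_triple = braided_slim +
  fixes a b c
  assumes abc [simp]: "a \<in> X" "b \<in> X" "c \<in> X"
    and neq: "a \<noteq> b" "b \<noteq> c" "a \<noteq> c"
    and ab: "act a b \<noteq> b"
begin

abbreviation (input) "f \<equiv> act b a"
abbreviation (input) "h \<equiv> act c b"
abbreviation (input) "d \<equiv> act c f"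
abbreviation (input) "e \<equiv> act d h"

lemma ba: "f \<noteq> a" using ab noncomm_sym by simp

lemma X_closed [simp]: "f \<in> X" "h \<in> X" "d \<in> X" "e \<in> X" "act c a \<in> X"
  by (simp_all add: act_closed)

lemma f_neq: "f \<noteq> b" using act_inj[of b a b] idem[of b] neq by auto

text \<open>Translate \<open>act f b = a\<close> by \<open>c\<close>. Thus \<open>h\<close>,
  \<open>e\<close>, \<open>d\<close> are the translates of \<open>b\<close>, \<open>a\<close>,
  \<open>f\<close> and inherit their relations, as in \<open>h_e\<close> and
  \<open>e_d\<close>.\<close>

lemma e_eq: "e = act c a"
  using act_dist[of c f b] act_act_self[of b a] ba by simp

lemma h_e: "act h (act c a) = d"
  using act_dist[of c b a] by simp

lemma d_neq_ca: "d \<noteq> act c a" using act_inj[of c f a] ba by auto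

lemma d_h: "act d h = act c a" using e_eq .

lemma d_neq_h: "h \<noteq> d" using act_inj[of c b f] f_neq by auto

lemma ca_neq_h: "act c a \<noteq> h" using act_inj[of c a b] neq by auto

lemma e_d: "act (act c a) d = h"
  using act_act_self[of d h] d_h ca_neq_h by simp

text \<open>The left side is the scalar that c_1c_2 produces from cba. The right side exposes the
  factor \<open>q h (act c a)\<close> of the degree two relation of v_h v_e.\<close>

lemma cocycle_abc: "q b a * q c f = q c a * q h (act c a)"
  using cocycle[of c b a] by (simp add: mult.commute)

lemma cube_hed: "q h (act c a) * q d h * q (act c a) d = -1"
  using braid_cube[of h "act c a"] d_neq_ca by (simp add: h_e)

lemma Zelem_eq:
  "Zelem act q c b a = (\<lambda>w. wd [c, b, a] w - (q c a * q h (act c a)) * wd [d, c, b] w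
     + (q c a * q h (act c a) * q c b * q d h) * wd [act c a, d, c] w)"
  unfolding Zelem_def Let_def cocycle_abc[symmetric]
  by (simp only: braid_0 braid_1 lin_smult[OF lin_braid] fsupp_wd fsupp_smult d_h) (simp add: algebra_simps)

abbreviation (input) "Z \<equiv> Zelem act q c b a"
abbreviation (input) "S \<equiv> {wd [a], wd [b], wd [d], wd [act c a]} :: ('a list \<Rightarrow> 'b) set"
abbreviation (input) "C \<equiv> nsat act q X (gen_alg (insert Z S))"
abbreviation (input) "M \<equiv> {R \<in> C. act_homog R}"

lemma Z_TV: "Z \<in> TV"
  unfolding Zelem_eq
  by (intro subsp_add[OF subsp_TV] subsp_diff[OF subsp_TV] subsp_smult[OF subsp_TV]) simp_all

lemma gens_TV: "insert Z S \<subseteq> TV"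
  using Z_TV by simp

lemma supp_Z: "supp Z \<subseteq> {[c, b, a], [d, c, b], [act c a, d, c]}"
proof
  fix w assume "w \<in> supp Z"
  moreover have "Z w = 0" if "w \<notin> {[c, b, a], [d, c, b], [act c a, d, c]}"
    unfolding Zelem_eq using that by (simp add: wd_def)
  ultimately show "w \<in> {[c, b, a], [d, c, b], [act c a, d, c]}" unfolding supp_def by blast
qed

lemma deg_homog_Z: "deg_homog X act Z"
proof -
  have 1: "same_deg X act [c, b, a] [d, c, b]"
    using same_deg_braid[of b X a act "[c]" "[]"] same_deg_braid[of c X f act "[]" "[b]"]
    by (auto intro: same_deg_trans)
  have 2: "same_deg X act [d, c, b] [act c a, d, c]"
    using same_deg_braid[of c X b act "[d]" "[]"] same_deg_braid[of d X h act "[]" "[c]"]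
    by (auto simp: d_h intro: same_deg_trans)
  have 3: "same_deg X act u u" for u by (simp add: same_deg_def gx_eq.refl)
  have "length w = 3 \<and> same_deg X act w [d, c, b]" if "w \<in> supp Z" for w
    using subsetD[OF supp_Z that] 1 same_deg_sym[OF 2] 3 by auto
  then show ?thesis unfolding deg_homog_def using same_deg_sym same_deg_trans by metis
qed

lemma act_homog_Z: "act_homog Z"
proof -
  have 1: "gacts [c, b, a] g = gacts [d, c, b] g" if g: "g \<in> TV" for g
    using gact_gact[of a b g] gact_gact[of f c "gact b g"] g by (simp add: gact_TV)
  have 2: "gacts [d, c, b] g = gacts [act c a, d, c] g" if g: "g \<in> TV" for g
    using gact_gact[of b c g] gact_gact[of h d "gact c g"] g by (simp add: gact_TV d_h)
  have "gacts w g = gacts [d, c, b] g" if "w \<in> supp Z" "g \<in> TV" for w g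
    using subsetD[OF supp_Z that(1)] 1[OF that(2)] 2[OF that(2)] by auto
  then show ?thesis unfolding act_homog_def by metis
qed

lemma act_homog_wd: "act_homog (wd u)"
  by (simp add: act_homog_def supp_wd)

lemma wd_gen: "set u \<subseteq> {a, b, d, act c a} \<Longrightarrow> wd u \<in> gen_alg (insert Z S)"
proof (induction u)
  case Nil
  then show ?case using gen_alg.unit by simp
next
  case (Cons x u)
  have "wd [x] \<in> gen_alg (insert Z S)" by (rule gen_alg.base) (use Cons.prems in auto)
  moreover have "wd u \<in> gen_alg (insert Z S)" using Cons by simp
  ultimately have "tmul (wd [x]) (wd u) \<in> gen_alg (insert Z S)" by (rule gen_alg.mult)
  then show ?case by (simp add: tmul_wd)
qed

lemma wd_M: "set u \<subseteq> {a, b, d, act c a} \<Longrightarrow> wd u \<in> M"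
  using wd_gen gen_alg_nsat[OF gens_TV] act_homog_wd by blast

lemma Z_M: "Z \<in> M"
  using gen_alg_nsat[OF gens_TV] gen_alg.base[of Z "insert Z S"] act_homog_Z by blast

lemma ca_M: "(\<lambda>w. wd [c, a] w - q c a * wd [act c a, c] w) \<in> M"
proof -
  let ?R = "\<lambda>w. wd [c, a] w - q c a * wd [act c a, c] w"
  have "supp ?R \<subseteq> {[c, a], [act c a, c]}" by (auto simp: supp_def wd_def split: if_splits)
  moreover have "gacts [act c a, c] g = gacts [c, a] g" if "g \<in> TV" for g
    using gact_gact[of a c g] that by simp
  ultimately have "act_homog ?R"
    unfolding act_homog_def by (smt (verit) insertE singletonD subsetD)
  moreover have "?R \<in> C"
  proof (cases "act c a = a")
    case True
    then show ?thesis using slim_comm[of c a] neq NI_nsat[OF gens_TV] by auto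
  next
    case False
    let ?G = "\<lambda>w. ?R w + q c a * q (act c a) c * wd [a, act c a] w"
    have "?G \<in> C" using slim_braid[of c a] False NI_nsat[OF gens_TV] by auto
    moreover have "wd [a, act c a] \<in> C" using wd_M[of "[a, act c a]"] by simp
    ultimately have "(\<lambda>w. ?G w + (- (q c a * q (act c a) c)) * wd [a, act c a] w) \<in> C"
      by (rule subsp_lincomb[OF subsp_nsat[OF gens_TV]])
    then show ?thesis by simp
  qed
  ultimately show ?thesis by blast
qed

lemma he_NI:
  "(\<lambda>w. wd [h, act c a] w - q h (act c a) * wd [d, h] w + q h (act c a) * q d h * wd [act c a, d] w) \<in> NI"
  using slim_braid[of h "act c a"] d_neq_ca by (simp add: h_e)

lemma wd_pair: "wd (p, r) (l, s) = (wd p l * wd r s :: 'k::comm_ring_1)"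
  by (simp add: wd_def)

text \<open>The components d \<otimes> cb and e \<otimes> dc are missing because consecutive
  summands of \<open>Z\<close> contribute them with opposite signs. The last line collects the terms
  ending in \<open>c\<close> in degree (2,1).\<close>

lemma cop_Z:
  defines "\<alpha> \<equiv> q c a * q h (act c a)"
  defines "\<beta> \<equiv> \<alpha> * q c b * q d h"
  shows "cop act q Z = (\<lambda>t. tens Z (wd []) t + tens (wd []) Z t + tens (wd [c]) (wd [b, a]) t
    + (- (\<alpha> * q d c)) * tens (wd [act d c]) (wd [d, b]) t
    + (\<beta> * q d c * q (act c a) (act d c)) * tens (wd [act (act c a) (act d c)]) (wd [act c a, d]) t
    + q c b * tens (wd [h]) (\<lambda>w. wd [c, a] w - q c a * wd [act c a, c] w) t
    + tens (wd [c, b]) (wd [a]) t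
    + (q b a * tens (wd [c, f]) (wd [b]) t + (- \<alpha>) * tens (wd [d, c]) (wd [b]) t)
    + ((- (\<alpha> * q d c * q d b)) * tens (wd [act d c, act d b]) (wd [d]) t
        + (\<beta> * q d c) * tens (wd [act c a, act d c]) (wd [d]) t)
    + (\<beta> * q (act c a) d * q (act c a) c) * tens (wd [h, act (act c a) c]) (wd [act c a]) t
    + (q c b * q c a) * tens (\<lambda>w. wd [h, act c a] w - q h (act c a) * wd [d, h] w
        + q h (act c a) * q d h * wd [act c a, d] w) (wd [c]) t)"
    (is "_ = ?rhs")
proof
  fix t :: "'a list \<times> 'a list"
  obtain l r where t: "t = (l, r)" by (cases t)
  have Z: "cop act q Z t = cop_word act q [c, b, a] t - \<alpha> * cop_word act q [d, c, b] t
      + \<beta> * cop_word act q [act c a, d, c] t"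
    unfolding Zelem_eq \<alpha>_def \<beta>_def
    by (simp only: lin_lincomb[OF lin_cop] lin_diff[OF lin_cop] lin_smult[OF lin_cop] cop_wd
        fsupp_wd fsupp_smult fsupp_lincomb[of _ _ "-1", simplified])
  \<comment> \<open>The two sides differ only in the coefficient of h \<otimes> ec: it is \<beta>
    times \<open>q (act c a) d\<close> on the left and minus \<open>q c b * q c a\<close> on the
    right. These agree by \<open>cube_hed\<close>.\<close>
  have "cop act q Z t - ?rhs t = (q c b * q c a * wd [h] l * wd [act c a, c] r) *
      (q h (act c a) * q d h * q (act c a) d + 1)"
    unfolding Z
    unfolding cop_word_3 cocycle_abc d_h e_d t wd_pair tens_def prod.case Zelem_eq \<alpha>_def \<beta>_def
    by (simp add: algebra_simps)
  then show "cop act q Z t = ?rhs t" by (simp add: cube_hed)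
qed

text \<open>Each summand of \<open>cop_Z\<close> has its right factor in \<open>M\<close>, except
  the one with right factor v_c, whose left factor is a relation.\<close>

lemma cop_Z_tsum: "cop act q Z \<in> tsum M"
proof -
  have "tens (\<lambda>w. wd [h, act c a] w - q h (act c a) * wd [d, h] w
      + q h (act c a) * q d h * wd [act c a, d] w) (wd [c]) \<in> tsum M"
    by (rule tsum.left[OF he_NI]) simp
  then show ?thesis
    unfolding cop_Z
    by (intro subsp_add[OF subsp_tsum] tsum_smult;
        (assumption | intro tsum.right wd_M Z_M ca_M Z_TV; simp add: act_closed))
qed

theorem left_coideal_subalg_C: "left_coideal_subalg act q X C"
proof (rule left_coideal_subalg_generated[OF gens_TV])
  fix g assume g: "g \<in> insert Z S"
  show "deg_homog X act g \<and> act_homog g"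
    using g deg_homog_Z act_homog_Z act_homog_wd
    by (auto simp: deg_homog_def supp_wd same_deg_def intro: gx_eq.refl)
  have "cop act q (wd [s]) \<in> tsum M" if "s \<in> {a, b, d, act c a}" for s
  proof -
    have "s \<in> X" using that by auto
    then have "tens (wd [s]) (wd []) \<in> tsum M" "tens (wd []) (wd [s]) \<in> tsum M"
      using that by (auto intro!: tsum.right wd_M)
    from tsum.add[OF this] show ?thesis by (simp add: cop_word_1 tens_wd del: cop_word.simps)
  qed
  moreover have "g = Z \<or> (\<exists>s\<in>{a, b, d, act c a}. g = wd [s])" using g by blast
  ultimately show "cop act q g \<in> tsum M"
  proof (elim disjE bexE)
    assume "g = Z"
    then show ?thesis using cop_Z_tsum by (simp only:)
  qed (simp only:)
qed

section \<open>The second claim: Z is not generated by letters\<close>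

context
  assumes ca: "act c a \<noteq> a" and cb: "h \<noteq> b" and cf: "d \<noteq> f"
    and not_swapped: "act a b \<noteq> c \<or> act a c \<noteq> f"
begin

lemma f_neq_c: "f \<noteq> c"
  using cf idem by auto

lemma gens_neq_c: "d \<noteq> c" "act c a \<noteq> c"
proof -
  show "d \<noteq> c" using act_inj[of c f c] f_neq_c idem by auto
  show "act c a \<noteq> c" using act_inj[of c a c] neq idem by auto
qed

text \<open>Translation by \<open>a\<close> sends \<open>f\<close> to \<open>b\<close> and
  \<open>act c a\<close> to \<open>c\<close>.\<close>

lemma f_neq_ca: "f \<noteq> act c a"
  using act_act_other[of a b] act_act_other[of a c] noncomm_sym[of c a] ab ca neq by auto

text \<open>Translation by \<open>b\<close> sends \<open>h\<close> to \<open>c\<close> and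
  \<open>a\<close> to \<open>f\<close>, and these differ by \<open>f_neq_c\<close>.\<close>

lemma h_neq_a: "h \<noteq> a"
  using act_act_other[of b c] noncomm_sym[of c b] cb f_neq_c by auto

lemma act_a_neq_h: "x \<in> {a, b, d, act c a} \<Longrightarrow> act a x \<noteq> h"
proof -
  \<comment> \<open>Translation by \<open>b\<close> sends \<open>act a b\<close> to \<open>a\<close>
    and \<open>h\<close> to \<open>c\<close>.\<close>
  have "act a b \<noteq> h"
    using act_act_other[of b a] act_act_other[of b c] ba noncomm_sym[of c b] cb neq by auto
  moreover have "act a d \<noteq> h"
  proof
    assume *: "act a d = h"
    \<comment> \<open>Since \<open>h\<close> differs from \<open>d\<close>, the elements
      \<open>a\<close> and \<open>d\<close> do not commute. The braided axiom gives
      \<open>a\<close>, whereas \<open>act d h = act c a\<close>, which differs from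
      \<open>a\<close>.\<close>
    then have "act d (act a d) = a" using act_act_other[of d a] noncomm_sym[of a d] d_neq_h by auto
    then show False using * d_h ca by simp
  qed
  moreover have "act a (act c a) = c" using act_act_other[of a c] noncomm_sym[of c a] ca by simp
  moreover have "h \<noteq> c" using act_inj[of c b c] idem neq by auto
  ultimately show "x \<in> {a, b, d, act c a} \<Longrightarrow> act a x \<noteq> h" using h_neq_a idem by auto
qed

text \<open>Because \<open>act a (act c a) = c\<close> and \<open>act d c = f\<close>, the
  coincidence would force \<open>act a b = c\<close> and \<open>act a c = f\<close>, which
  \<open>not_swapped\<close> forbids.\<close>

lemma swapped: "\<not> (d = a \<and> act c a = b)"
proof
  assume *: "d = a \<and> act c a = b"
  have "act a (act c a) = c" using act_act_other[of a c] noncomm_sym[of c a] ca by simp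
  moreover have "act d c = f" using act_act_self[of c f] cf by simp
  ultimately show False using * not_swapped by auto
qed

lemma act_b_eq_c: "x \<in> X \<Longrightarrow> act b x = c \<longleftrightarrow> x = h"
  using act_inj[of b x h] act_act_other[of b c] noncomm_sym[of c b] cb by auto

lemma act_a_eq_b: "x \<in> X \<Longrightarrow> act a x = b \<longleftrightarrow> x = f"
  using act_inj[of a x f] act_act_other[of a b] ab by auto

text \<open>Each of the six terms would need one of \<open>x = c\<close>, \<open>y = h\<close>,
  \<open>y = f\<close>, \<open>z = f\<close> or \<open>act a z = h\<close>. All of these have been
  excluded.\<close>

lemma derivs_abc_letters:
  assumes "x \<in> {a, b, d, act c a}" "y \<in> {a, b, d, act c a}" "z \<in> {a, b, d, act c a}"
  shows "derivs [a, b, c] (wd [x, y, z]) [] = 0"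
proof -
  have X: "x \<in> X" "y \<in> X" "z \<in> X" using assms by auto
  have h: "u \<noteq> h" if "u \<in> {a, b, d, act c a}" for u
    using that h_neq_a cb d_neq_h ca_neq_h by auto
  have f: "u \<noteq> f" if "u \<in> {a, b, d, act c a}" for u
    using that ba f_neq cf f_neq_ca by auto
  have "x \<noteq> c" using assms(1) neq gens_neq_c by auto
  then show ?thesis
    using h[OF assms(2)] f[OF assms(2)] f[OF assms(3)] act_a_neq_h[OF assms(3)] X
    unfolding derivs_word_3 derivs_word_2 by (auto simp: act_b_eq_c act_a_eq_b act_closed)
qed

text \<open>Only the trivial term of cba survives. For the second word \<open>d = a\<close> would be
  needed, and then \<open>act a b = b\<close> or \<open>act b (act a b) = c\<close>, both
  impossible. For the third only \<open>d = a\<close> with \<open>act c a = b\<close> remains,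
  excluded by \<open>swapped\<close>.\<close>

lemma derivs_abc_Z: "derivs [a, b, c] Z [] = 1"
proof -
  have 1: "derivs [a, b, c] (wd [c, b, a]) [] = 1"
    unfolding derivs_word_3 derivs_word_2 using neq by auto
  have 2: "derivs [a, b, c] (wd [d, c, b]) [] = 0"
    unfolding derivs_word_3 derivs_word_2 using neq f_neq ab
      act_act_other[of b a] ba by (auto simp: act_b_eq_c act_a_eq_b)
  have 3: "derivs [a, b, c] (wd [act c a, d, c]) [] = 0"
    unfolding derivs_word_3 derivs_word_2 using neq gens_neq_c ca swapped f_neq_c
    by (auto simp: act_a_eq_b)
  show ?thesis
    unfolding Zelem_eq using 1 2 3
    by (simp only: lin_lincomb[OF lin_derivs] lin_diff[OF lin_derivs] lin_smult[OF lin_derivs]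
        fsupp_wd fsupp_smult fsupp_lincomb[of _ _ "-1", simplified]) simp
qed

text \<open>The functional given by \<open>derivs [a, b, c]\<close> at \<open>[]\<close> vanishes on
  the ideal and on all words over the generating letters (for length other than 3 by degree), yet
  equals 1 on \<open>Z\<close>.\<close>

theorem Z_notin: "Z \<notin> nsat act q X (gen_alg S)"
proof
  assume Z: "Z \<in> nsat act q X (gen_alg S)"
  have S: "S \<subseteq> TV" using gens_TV by blast
  obtain u where u: "u \<in> gen_alg S" "(\<lambda>w. Z w - u w) \<in> NI"
    using Z unfolding nsat_gen_iff[OF S] by blast
  have su: "fsupp u \<and> supp u \<subseteq> lists {a, b, d, act c a}"
    by (rule gen_alg_support[OF u(1)]) (auto simp: supp_wd)
  have "(\<lambda>w. if w = [] then derivs [a, b, c] u w else 0) = (\<lambda>_. 0)"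
  proof (rule lin_ext[OF lin_comp[OF lin_restrict lin_derivs] lin_null])
    fix w assume w: "w \<in> lists {a, b, d, act c a}"
    have "derivs [a, b, c] (wd w) [] = 0"
    proof (cases "length w = 3")
      case True
      then obtain x y z where "w = [x, y, z]"
        by (auto simp: numeral_3_eq_3 length_Suc_conv)
      then show ?thesis using derivs_abc_letters[of x y z] w by (simp del: derivs.simps)
    next
      case False
      then show ?thesis using derivs_at_word_length[of "[a, b, c]" w] by simp
    qed
    then show "(\<lambda>v. if v = [] then derivs [a, b, c] (wd w) v else 0) = (\<lambda>_. 0)" by auto
  qed (use su in auto)
  then have "derivs [a, b, c] u [] = 0" by metis
  moreover have "derivs [a, b, c] (\<lambda>w. Z w - u w) [] = 0" using u(2) unfolding NI_def by blast
  ultimately show False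
    using derivs_abc_Z su TV_fsupp[OF Z_TV] by (simp add: lin_diff[OF lin_derivs] del: derivs.simps)
qed

theorem C_not_gen_in_deg_one: "\<not> gen_in_deg_one act q X C"
proof (rule not_gen_in_deg_one[OF _ Z_TV _ Z_notin])
  show "hom 1 Z = (\<lambda>_. 0)"
    using supp_Z by (auto simp: hom_def supp_def fun_eq_iff)
qed (use gens_TV in \<open>auto simp: hom_wd\<close>)

end

end

section \<open>Conjugation in a group as a rack\<close>

context group
begin

lemma conj_act_hom:
  assumes "x \<in> carrier G" "y \<in> carrier G" "z \<in> carrier G"
  shows "conj_act G (conj_act G x y) (conj_act G x z) = conj_act G x (conj_act G y z)"
  using assms by (simp add: conj_act_def m_assoc inv_mult_group inv_solve_left')

lemma conj_act_cancel:
  assumes "x \<in> carrier G" "y \<in> carrier G"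
  shows "conj_act G (inv x) (conj_act G x y) = y" "conj_act G x (conj_act G (inv x) y) = y"
proof -
  have *: "inv x \<otimes> (x \<otimes> z) = z" "x \<otimes> (inv x \<otimes> z) = z" if "z \<in> carrier G" for z
    using assms that by (simp_all flip: m_assoc)
  show "conj_act G (inv x) (conj_act G x y) = y" "conj_act G x (conj_act G (inv x) y) = y"
    using assms * by (simp_all add: conj_act_def m_assoc)
qed

lemma conj_act_idem: "x \<in> carrier G \<Longrightarrow> conj_act G x x = x"
  by (simp add: conj_act_def m_assoc)

end

theorem mainTheorem12:
  fixes G :: "('g, 'm) monoid_scheme" and X :: "'g set"
    and q :: "'g \<Rightarrow> 'g \<Rightarrow> 'k::field_char_0" and a b c :: 'g
  assumes alg_closed: "\<forall>p::'k poly. degree p > 0 \<longrightarrow> (\<exists>z. poly p z = 0)"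
    and grp: "group G" and XG: "X \<subseteq> carrier G"
    and conjcl: "\<forall>g\<in>carrier G. \<forall>x\<in>X. g \<otimes>\<^bsub>G\<^esub> x \<otimes>\<^bsub>G\<^esub> inv\<^bsub>G\<^esub> g \<in> X"
    and braided: "braided_rack X (conj_act G)"
    and cocycle: "two_cocycle X (conj_act G) q"
    and slim: "slim2 (conj_act G) q X"
    and abc: "a \<in> X" "b \<in> X" "c \<in> X" "a \<noteq> b" "b \<noteq> c" "a \<noteq> c"
    and ab: "conj_act G a b \<noteq> b"
  shows "let act = conj_act G;
             d = act c (act b a);
             e = act d (act c b);
             S = {wd [a], wd [b], wd [d], wd [e]};
             Z = Zelem act q c b a;
             C = nsat act q X (gen_alg (insert Z S))
         in left_coideal_subalg act q X C \<and>
            ((\<not> commutes act c a \<and> \<not> commutes act c b \<and> \<not> commutes act c (act b a) \<and>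
              (act a b \<noteq> c \<or> act a c \<noteq> act b a))
             \<longrightarrow> Z \<notin> nsat act q X (gen_alg S) \<and> \<not> gen_in_deg_one act q X C)"
proof -
  interpret group G by (rule grp)
  \<comment> \<open>Stated for all \<open>x\<close> in the carrier, because surjectivity of a
    translation uses conjugation by an inverse, which may lie outside \<open>X\<close>.\<close>
  have closed: "conj_act G x y \<in> X" if "x \<in> carrier G" "y \<in> X" for x y
    using conjcl that unfolding conj_act_def by blast
  interpret noncomm_triple "conj_act G" q X a b c
  proof
    fix x y assume xy: "x \<in> X" "y \<in> X"
    then have xyG: "x \<in> carrier G" "y \<in> carrier G" using XG by auto
    show "conj_act G x y \<in> X" using closed xy xyG by simp
    show "conj_act G x x = x" using xyG conj_act_idem by simp
    show "\<exists>z\<in>X. conj_act G x z = y"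
      using closed[of "inv\<^bsub>G\<^esub> x" y] conj_act_cancel(2) xy xyG by blast
    fix z assume z: "z \<in> X"
    show "conj_act G (conj_act G x y) (conj_act G x z) = conj_act G x (conj_act G y z)"
      using conj_act_hom xyG z XG by blast
    show "y = z" if "conj_act G x y = conj_act G x z"
      using conj_act_cancel(1) that xyG z XG by (metis subsetD)
    show "q (conj_act G x y) (conj_act G x z) * q x z = q x (conj_act G y z) * q y z"
      using cocycle xy z unfolding two_cocycle_def by blast
  qed (use braided slim abc ab in auto)
  show ?thesis
    \<comment> \<open>The locale results are stated with \<open>act c a\<close> in place of e, so
      \<open>e_eq\<close> brings the goal to that form.\<close>
    unfolding Let_def commutes_def e_eq
    using left_coideal_subalg_C Z_notin C_not_gen_in_deg_one by blast
qed

end
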